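(* Let $\mathbf u=2^{-53}$, let $m,s,n$ be positive integers with $n\le s\le m$, and let $X\in\mathbb{R}^{m\times n}$ with $\mathrm{rank}(X)=n$. Let $\epsilon\in(0,1)$, $p\in[0,1)$, and let $S\in\mathbb{R}^{s\times m}$ be a random matrix that is an $(\epsilon,p,n)$ oblivious $\ell_2$-subspace embedding in $\mathbb{R}^m$. Let $[\hat Q,\hat R]=\mathrm{RCLUPP}(X)$ be the factors computed in floating-point arithmetic by the algorithm RCLUPP with sketch matrix $S$, under the rounding error model given in the context, with computed intermediate matrices $\hat X_s,\hat M,\hat N,\hat Q_s,\hat R_0,\hat R_1,\hat Q_1,\dots$ and error matrix $E_a=SX-\hat X_s$ as described there. Put $$k_0=\frac{\|X\|_F}{\|X\|_2},\quad k_1=\frac{\|\hat M\|_F}{\|\hat M\|_2},\quad k=\frac{\|E_a\|_F}{\|X\|_2},\quad p_1=\max(\sqrt n,\|S\|_F),\quad p_2=\max\Big(k_1n\sqrt n\,\mathbf u,\ \frac{k}{\sqrt{1-\epsilon}-k}\Big).$$ Assume that the following conditions hold (for all realizations of $S$): 1. $\displaystyle \max\Big(\tfrac{40}{3}\sqrt{mn\mathbf u+n(n+1)\mathbf u}+0.1,\ \tfrac{5}{39}\Big)<\frac{\sqrt{1-\epsilon}}{\sqrt{1+\epsilon}}<1$; 2. $\displaystyle \sqrt{1-\epsilon}>1.02\,m\sqrt n\,\mathbf u\,\|S\|_F$; 3. $\displaystyle \mathbf u\le\min\Big(\frac{1}{64p_1m\sqrt n},\ \frac{1}{64sn\sqrt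 n},\ \frac{\sqrt{1-\epsilon}}{1.02\,k_0m\|S\|_F}\Big)$; 4. $\displaystyle \kappa_2(\hat M)\le\frac{1}{25.5\,s\,n\,k_1\mathbf u}$; 5. $\displaystyle \kappa_2(\hat M)\,\kappa_2(\hat N)\le\frac{1}{21.4\,p_2}$. Then, with probability at least $1-p$, $$\|\hat Q^{\top}\hat Q-I_n\|_F\le 6\big(mn\mathbf u+n(n+1)\mathbf u\big)$$ and $$\|\hat Q\hat R-X\|_F\le \frac{4.36}{\sqrt{1-\epsilon}}\,h\,n\sqrt n\,\mathbf u\,\|X\|_F+\frac{3.02}{\sqrt{1-\epsilon}}\,h\,n^2\,\mathbf u\,\|X\|_2,\qquad\text{where } h=\frac{1}{\frac{0.78}{\sqrt{1+\epsilon}}-\frac{0.1}{\sqrt{1-\epsilon}}}.$$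
   Context: Notation. $\|\cdot\|_F$ and $\|\cdot\|_2$ are the Frobenius and spectral norms. For a matrix $A$ with at least as many rows as columns ($n$ columns), $\sigma_1(A)\ge\dots\ge\sigma_n(A)$ are its singular values and $\kappa_2(A)=\sigma_1(A)/\sigma_n(A)$ (so a bound $\kappa_2(A)\le C$ with $C$ finite includes that $A$ has full column rank). $|A|$ is the entrywise absolute value, and inequalities between matrices are entrywise. Hats denote quantities computed in floating-point arithmetic with unit roundoff $\mathbf u=2^{-53}$. Subspace embedding. $S\in\mathbb{R}^{s\times m}$ is an $\epsilon$-embedding for a subspace $\mathcal K\subset\mathbb{R}^m$ if $(1-\epsilon)\|x\|_2^2\le\|Sx\|_2^2\le(1+\epsilon)\|x\|_2^2$ for all $x\in\mathcal K$. A random $S$ is an $(\epsilon,p,n)$ oblivious $\ell_2$-subspace embedding if, for every fixed $n$-dimensional subspace $\mathcal K\subset\mathbb{R}^m$, $S$ is an $\epsilon$-embedding for $\mathcal K$ with probability at least $1-p$. Algorithm RCLUPP (exact form). Input $X\in\mathbb{R}^{m\times n}$, $S\in\mathbb{R}^{s\times m}$. (1) $X_s=SX$. (2) LU decomposition with partial pivoting $PX_s=MN$, where $P\in\mathbb{R}^{s\times s}$ is a permutation matrix, $M\in\mathbb{R}^{s\times n}$ is lower triangular (trapezoidal) and $N\in\mathbb{R}^{n\times n}$ is upper triangular. (3) Thin Householder QR $M=Q_sR_0$, with $Q_s\in\mathbb{R}^{s\times n}$ and $R_0\in\mathbb{R}^{n\times n}$ upper triangular. (4) $R_1=R_0N$.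 (5) $Q_1=XR_1^{-1}$. (6) CholeskyQR2 on $Q_1$: $G=Q_1^\top Q_1$, $G=R_2^\top R_2$ (Cholesky), $Q_2=Q_1R_2^{-1}$; $G_1=Q_2^\top Q_2$, $G_1=R_4^\top R_4$ (Cholesky), $Q=Q_2R_4^{-1}$. (7) $R=ZR_1$ with $Z=R_4R_2$, formed as $R_3=R_2R_1$, $R=R_4R_3$. Rounding error model. The computed matrices satisfy, with $\hat R_0,\hat R_1,\hat R_2,\hat R_3,\hat R_4,\hat R,\hat N\in\mathbb{R}^{n\times n}$ upper triangular, $\hat X_s,\hat M,\hat Q_s\in\mathbb{R}^{s\times n}$, and $\hat Q_1,\hat Q_2,\hat Q\in\mathbb{R}^{m\times n}$: - $E_a=SX-\hat X_s$, $|E_a|\le1.02m\mathbf u\,|S||X|$; - $E_b=P\hat X_s-\hat M\hat N$, $|E_b|\le1.02n\mathbf u\,|\hat M||\hat N|$; - $E_c=\hat M-\hat Q_s\hat R_0$, $|E_c|\le1.02sn\mathbf u\,|\hat M|$, and $\|\hat Q_s^\top\hat Q_s-I_n\|_F\le0.02$; - $E_d=\hat R_0\hat N-\hat R_1$, $|E_d|\le1.02n\mathbf u\,|\hat R_0||\hat N|$; - $E_e=\hat Q_1\hat R_1-X$, $|E_e|\le1.02n\mathbf u\,|\hat Q_1||\hat R_1|$; - $\hat G=\hat Q_1^\top\hat Q_1+E_1$, $|E_1|\le1.02m\mathbf u\,|\hat Q_1^\top||\hat Q_1|$; - $\hat R_2^\top\hat R_2=\hat G+E_2$, $|E_2|\le1.02(n+1)\mathbf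 u\,|\hat R_2^\top||\hat R_2|$; - $\hat Q_2\hat R_2=\hat Q_1+E_3$, $|E_3|\le1.02n\mathbf u\,|\hat Q_2||\hat R_2|$; - $\hat R_3=\hat R_2\hat R_1+E_4$, $|E_4|\le1.02n\mathbf u\,|\hat R_2||\hat R_1|$; - $\hat G_1=\hat Q_2^\top\hat Q_2+E_5$, $|E_5|\le1.02m\mathbf u\,|\hat Q_2^\top||\hat Q_2|$; - $\hat R_4^\top\hat R_4=\hat G_1+E_6$, $|E_6|\le1.02(n+1)\mathbf u\,|\hat R_4^\top||\hat R_4|$; - $\hat Q\hat R_4=\hat Q_2+E_7$, $|E_7|\le1.02n\mathbf u\,|\hat Q||\hat R_4|$; - $\hat R=\hat R_4\hat R_3+E_8$, $|E_8|\le1.02n\mathbf u\,|\hat R_4||\hat R_3|$. *)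

theory Defs
  imports "HOL-Probability.Probability"
begin

text \<open>
  An \<open>m \<times> n\<close> real matrix is an element of \<open>real^'n^'m\<close> with \<open>CARD('m) = m\<close> and
  \<open>CARD('n) = n\<close>. The library norm of this type is the Frobenius norm, and the library absolute
  value and order are entrywise.
\<close>

abbreviation frob_norm :: "real^'n^'m \<Rightarrow> real" where
  "frob_norm A \<equiv> norm A"

lemma frob_norm_eq: "frob_norm A = sqrt (\<Sum>i\<in>UNIV. \<Sum>j\<in>UNIV. (A $ i $ j)\<^sup>2)"
  by (simp add: norm_vec_def L2_set_def sum_nonneg)

lemma abs_matrix_nth: "\<bar>A :: real^'n^'m\<bar> $ i $ j = \<bar>A $ i $ j\<bar>"
  by (simp add: abs_vec_def)

lemma le_matrix_iff: "(A :: real^'n^'m) \<le> B \<longleftrightarrow> (\<forall>i j. A $ i $ j \<le> B $ i $ j)"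
  by (simp add: less_eq_vec_def)

definition spectral_norm :: "real^'n^'m \<Rightarrow> real" where
  "spectral_norm A = onorm ((*v) A)"

text \<open>
  Singular values, as the square roots of the eigenvalues of \<open>A\<^sup>T A\<close>, taken without multiplicity.
  For a matrix with at least as many rows as columns these are all the
  \<open>\<sigma>\<^sub>1 \<ge> \<dots> \<ge> \<sigma>\<^sub>n\<close>, so that \<open>\<sigma>\<^sub>1\<close> is the maximum and \<open>\<sigma>\<^sub>n\<close> the minimum of this finite set.
\<close>

definition singular_values :: "real^'n^'m \<Rightarrow> real set" where
  "singular_values A = {sqrt \<mu> | \<mu>. \<exists>v. v \<noteq> 0 \<and> (transpose A ** A) *v v = \<mu> *\<^sub>R v}"

definition sigma_max :: "real^'n^'m \<Rightarrow> real" where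
  "sigma_max A = Max (singular_values A)"

definition sigma_min :: "real^'n^'m \<Rightarrow> real" where
  "sigma_min A = Min (singular_values A)"

text \<open>
  The value is extended real, because \<open>x / 0 = 0\<close> on the reals: a matrix without full column rank
  gets condition number \<open>\<infinity>\<close>, and a finite bound implies full column rank.
\<close>

definition cond_num :: "real^'n^'m \<Rightarrow> ereal" where
  "cond_num A = (if sigma_min A = 0 then \<infinity> else ereal (sigma_max A / sigma_min A))"

definition upper_triangular :: "real^'n::{finite,linorder}^'n::{finite,linorder} \<Rightarrow> bool" where
  "upper_triangular A \<longleftrightarrow> (\<forall>i j. j < i \<longrightarrow> A $ i $ j = 0)"

text \<open>Rows and columns of a rectangular matrix have different index types, so they are compared by
  their (zero-based) positions.\<close>

definition pos :: "'n::{finite,linorder} \<Rightarrow> nat" where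
  "pos i = card {j. j < i}"

definition lower_trapezoidal :: "real^'n::{finite,linorder}^'s::{finite,linorder} \<Rightarrow> bool" where
  "lower_trapezoidal A \<longleftrightarrow> (\<forall>i j. pos i < pos j \<longrightarrow> A $ i $ j = 0)"

definition permutation_matrix :: "real^'s^'s \<Rightarrow> bool" where
  "permutation_matrix P \<longleftrightarrow> (\<exists>\<pi>. bij \<pi> \<and> P = (\<chi> i j. if j = \<pi> i then 1 else 0))"

definition is_embedding :: "real \<Rightarrow> real^'m^'s \<Rightarrow> (real^'m) set \<Rightarrow> bool" where
  "is_embedding \<epsilon> S K \<longleftrightarrow>
     (\<forall>x\<in>K. (1 - \<epsilon>) * (norm x)\<^sup>2 \<le> (norm (S *v x))\<^sup>2 \<and> (norm (S *v x))\<^sup>2 \<le> (1 + \<epsilon>) * (norm x)\<^sup>2)"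

text \<open>A random matrix is a Borel measurable function on a probability space \<open>\<Omega>\<close>.\<close>

definition oblivious_embedding ::
    "'w measure \<Rightarrow> ('w \<Rightarrow> real^'m^'s) \<Rightarrow> real \<Rightarrow> real \<Rightarrow> nat \<Rightarrow> bool" where
  "oblivious_embedding \<Omega> S \<epsilon> p n \<longleftrightarrow>
     S \<in> borel_measurable \<Omega> \<and>
     (\<forall>K. subspace K \<and> dim K = n \<longrightarrow>
        measure \<Omega> {\<omega> \<in> space \<Omega>. is_embedding \<epsilon> (S \<omega>) K} \<ge> 1 - p)"

text \<open>
  ``\<open>P\<close> holds with probability at least \<open>q\<close>'' for a property \<open>P\<close> that need not define an event:
  it holds throughout some event of probability at least \<open>q\<close>. When \<open>{\<omega> \<in> space \<Omega>. P \<omega>}\<close> is an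
  event, this says exactly that its probability is at least \<open>q\<close>. So no measurability has to be
  required of the computed matrices.
\<close>

definition with_prob_at_least :: "'w measure \<Rightarrow> real \<Rightarrow> ('w \<Rightarrow> bool) \<Rightarrow> bool" where
  "with_prob_at_least \<Omega> q P \<longleftrightarrow> (\<exists>A\<in>sets \<Omega>. q \<le> measure \<Omega> A \<and> (\<forall>\<omega>\<in>A. P \<omega>))"

lemma (in prob_space) with_prob_at_least_iff:
  assumes "{\<omega> \<in> space M. P \<omega>} \<in> events"
  shows "with_prob_at_least M q P \<longleftrightarrow> q \<le> prob {\<omega> \<in> space M. P \<omega>}"
proof
  assume "with_prob_at_least M q P"
  then obtain A where A: "A \<in> events" "q \<le> prob A" "\<forall>\<omega>\<in>A. P \<omega>"
    by (auto simp: with_prob_at_least_def)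
  then have "A \<subseteq> {\<omega> \<in> space M. P \<omega>}"
    using sets.sets_into_space by blast
  then have "prob A \<le> prob {\<omega> \<in> space M. P \<omega>}"
    using assms by (rule finite_measure_mono)
  with A(2) show "q \<le> prob {\<omega> \<in> space M. P \<omega>}" by simp
next
  assume "q \<le> prob {\<omega> \<in> space M. P \<omega>}"
  with assms show "with_prob_at_least M q P"
    unfolding with_prob_at_least_def by (intro bexI[of _ "{\<omega> \<in> space M. P \<omega>}"]) auto
qed

text \<open>
  The matrices computed by one run of RCLUPP (\<open>m\<close> rows of the input, sketch dimension \<open>s\<close>,
  \<open>n\<close> columns). In exact arithmetic, for an input \<open>X\<close> and a sketch \<open>S\<close>:
  \<open>X\<^sub>s = S X\<close>; \<open>P X\<^sub>s = M N\<close> (LU with partial pivoting); \<open>M = Q\<^sub>s R\<^sub>0\<close> (thin Householder QR);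
  \<open>R\<^sub>1 = R\<^sub>0 N\<close>; \<open>Q\<^sub>1 = X R\<^sub>1\<^sup>-\<^sup>1\<close>;
  \<open>G = Q\<^sub>1\<^sup>T Q\<^sub>1 = R\<^sub>2\<^sup>T R\<^sub>2\<close> (Cholesky); \<open>Q\<^sub>2 = Q\<^sub>1 R\<^sub>2\<^sup>-\<^sup>1\<close>; \<open>R\<^sub>3 = R\<^sub>2 R\<^sub>1\<close>;
  \<open>G\<^sub>1 = Q\<^sub>2\<^sup>T Q\<^sub>2 = R\<^sub>4\<^sup>T R\<^sub>4\<close> (Cholesky); \<open>Q = Q\<^sub>2 R\<^sub>4\<^sup>-\<^sup>1\<close>; \<open>R = R\<^sub>4 R\<^sub>3\<close>.
\<close>

record ('m, 's, 'n) rclupp_run =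
  perm_P :: "real^'s^'s"
  hat_Xs :: "real^'n^'s"
  hat_M :: "real^'n^'s"
  hat_N :: "real^'n^'n"
  hat_Qs :: "real^'n^'s"
  hat_R0 :: "real^'n^'n"
  hat_R1 :: "real^'n^'n"
  hat_Q1 :: "real^'n^'m"
  hat_G :: "real^'n^'n"
  hat_R2 :: "real^'n^'n"
  hat_Q2 :: "real^'n^'m"
  hat_R3 :: "real^'n^'n"
  hat_G1 :: "real^'n^'n"
  hat_R4 :: "real^'n^'n"
  hat_Q :: "real^'n^'m"
  hat_R :: "real^'n^'n"

text \<open>
  Each bound is on a residual that the computed matrices determine: in this order, the residuals
  \<open>E\<^sub>a, E\<^sub>b, E\<^sub>c\<close>, then (after the orthogonality of \<open>Q\<^sub>s\<close>) \<open>E\<^sub>d, E\<^sub>e, E\<^sub>1, \<dots>, E\<^sub>8\<close>.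
\<close>

definition rclupp_error_model ::
    "real \<Rightarrow> real^'n::{finite,linorder}^'m \<Rightarrow> real^'m^'s::{finite,linorder} \<Rightarrow>
     ('m, 's, 'n) rclupp_run \<Rightarrow> bool" where
  "rclupp_error_model u X S c \<longleftrightarrow>
     (let m = real CARD('m); s = real CARD('s); n = real CARD('n) in
       permutation_matrix (perm_P c) \<and>
       lower_trapezoidal (hat_M c) \<and>
       upper_triangular (hat_N c) \<and> upper_triangular (hat_R0 c) \<and>
       upper_triangular (hat_R1 c) \<and> upper_triangular (hat_R2 c) \<and>
       upper_triangular (hat_R3 c) \<and> upper_triangular (hat_R4 c) \<and>
       upper_triangular (hat_R c) \<and>
       \<bar>S ** X - hat_Xs c\<bar> \<le> (1.02 * m * u) *\<^sub>R (\<bar>S\<bar> ** \<bar>X\<bar>) \<and>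
       \<bar>perm_P c ** hat_Xs c - hat_M c ** hat_N c\<bar>
         \<le> (1.02 * n * u) *\<^sub>R (\<bar>hat_M c\<bar> ** \<bar>hat_N c\<bar>) \<and>
       \<bar>hat_M c - hat_Qs c ** hat_R0 c\<bar> \<le> (1.02 * s * n * u) *\<^sub>R \<bar>hat_M c\<bar> \<and>
       frob_norm (transpose (hat_Qs c) ** hat_Qs c - mat 1) \<le> 0.02 \<and>
       \<bar>hat_R0 c ** hat_N c - hat_R1 c\<bar> \<le> (1.02 * n * u) *\<^sub>R (\<bar>hat_R0 c\<bar> ** \<bar>hat_N c\<bar>) \<and>
       \<bar>hat_Q1 c ** hat_R1 c - X\<bar> \<le> (1.02 * n * u) *\<^sub>R (\<bar>hat_Q1 c\<bar> ** \<bar>hat_R1 c\<bar>) \<and>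
       \<bar>hat_G c - transpose (hat_Q1 c) ** hat_Q1 c\<bar>
         \<le> (1.02 * m * u) *\<^sub>R (\<bar>transpose (hat_Q1 c)\<bar> ** \<bar>hat_Q1 c\<bar>) \<and>
       \<bar>transpose (hat_R2 c) ** hat_R2 c - hat_G c\<bar>
         \<le> (1.02 * (n + 1) * u) *\<^sub>R (\<bar>transpose (hat_R2 c)\<bar> ** \<bar>hat_R2 c\<bar>) \<and>
       \<bar>hat_Q2 c ** hat_R2 c - hat_Q1 c\<bar> \<le> (1.02 * n * u) *\<^sub>R (\<bar>hat_Q2 c\<bar> ** \<bar>hat_R2 c\<bar>) \<and>
       \<bar>hat_R3 c - hat_R2 c ** hat_R1 c\<bar> \<le> (1.02 * n * u) *\<^sub>R (\<bar>hat_R2 c\<bar> ** \<bar>hat_R1 c\<bar>) \<and>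
       \<bar>hat_G1 c - transpose (hat_Q2 c) ** hat_Q2 c\<bar>
         \<le> (1.02 * m * u) *\<^sub>R (\<bar>transpose (hat_Q2 c)\<bar> ** \<bar>hat_Q2 c\<bar>) \<and>
       \<bar>transpose (hat_R4 c) ** hat_R4 c - hat_G1 c\<bar>
         \<le> (1.02 * (n + 1) * u) *\<^sub>R (\<bar>transpose (hat_R4 c)\<bar> ** \<bar>hat_R4 c\<bar>) \<and>
       \<bar>hat_Q c ** hat_R4 c - hat_Q2 c\<bar> \<le> (1.02 * n * u) *\<^sub>R (\<bar>hat_Q c\<bar> ** \<bar>hat_R4 c\<bar>) \<and>
       \<bar>hat_R c - hat_R4 c ** hat_R3 c\<bar> \<le> (1.02 * n * u) *\<^sub>R (\<bar>hat_R4 c\<bar> ** \<bar>hat_R3 c\<bar>))"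

end

theory Submission
  imports Defs
begin

text \<open>
  On the event that the sketch embeds the range of \<open>X\<close>, the model gives the identity
  \<open>P S X = Q\<^sub>s R\<^sub>1 + Q\<^sub>s E\<^sub>d + E\<^sub>c N + E\<^sub>b + P E\<^sub>a\<close>, and the conditions on the condition numbers make
  the last four terms, applied to \<open>R\<^sub>1\<^sup>-\<^sup>1\<close>, at most 0.2044 in norm. Since \<open>Q\<^sub>s\<close> is nearly orthonormal and
  \<open>P S\<close> distorts the range of \<open>X\<close> by \<open>\<surd>(1 \<plusminus> \<epsilon>)\<close> only, \<open>X R\<^sub>1\<^sup>-\<^sup>1\<close>, and with it the computed \<open>Q\<^sub>1\<close>, is so
  well conditioned that \<open>T \<kappa>\<^sup>2 \<le> 1/64\<close> for \<open>T = m n u + n (n + 1) u\<close>. One Cholesky QR step turns a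
  matrix of condition number \<open>\<kappa>\<close> into one with orthogonality defect at most \<open>3.21 T \<kappa>\<^sup>2\<close>: the first
  step brings \<open>\<kappa>\<close> close to 1, and the second leaves a defect below \<open>6 T\<close>. The residual telescopes,
  \<open>Q R - X = E\<^sub>e + E\<^sub>3 R\<^sub>1 + Q\<^sub>2 E\<^sub>4 + E\<^sub>7 R\<^sub>3 + Q E\<^sub>8\<close>, and \<open>R\<^sub>1\<close> is bounded by \<open>X\<close> divided by the smallest
  singular value of \<open>Q\<^sub>1\<close>.
\<close>

section \<open>Spectral and Frobenius norms\<close>

lemma norm_matrix_vector_le_spectral: "norm (A *v v) \<le> spectral_norm A * norm v"
  for A :: "real^'n^'m"
  unfolding spectral_norm_def by (rule onorm) (rule matrix_vector_mul_bounded_linear)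

lemma spectral_norm_le: "spectral_norm A \<le> b" if "\<And>v. norm (A *v v) \<le> b * norm v"
  for A :: "real^'n^'m"
  unfolding spectral_norm_def using that by (rule onorm_le)

lemma spectral_norm_nonneg: "0 \<le> spectral_norm A" for A :: "real^'n^'m"
  unfolding spectral_norm_def by (rule onorm_pos_le) (rule matrix_vector_mul_bounded_linear)

lemma spectral_norm_eq_0: "spectral_norm A = 0 \<longleftrightarrow> A = 0" for A :: "real^'n^'m"
  by (metis matrix_eq matrix_vector_mul_bounded_linear matrix_vector_mult_0 onorm_eq_0
      spectral_norm_def)

lemma inner_matrix_transpose: "(A *v x) \<bullet> y = x \<bullet> (transpose A *v y)" for A :: "real^'n^'m"
  by (metis dot_lmul_matrix inner_commute transpose_matrix_vector transpose_transpose)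

lemma norm_matrix_vector_sq: "(norm (A *v x))\<^sup>2 = x \<bullet> ((transpose A ** A) *v x)"
  for A :: "real^'n^'m"
  by (simp add: power2_norm_eq_inner inner_matrix_transpose flip: matrix_vector_mul_assoc)

text \<open>The columns of \<open>A\<close> are the images of the standard basis vectors. This turns
  vectorwise bounds on \<open>A *v v\<close> into Frobenius bounds on products, one column at a
  time.\<close>

lemma frob_sq_columns: "(norm A)\<^sup>2 = (\<Sum>j\<in>UNIV. (norm (A *v axis j 1))\<^sup>2)" for A :: "real^'n^'m"
proof -
  have "(norm A)\<^sup>2 = (\<Sum>i\<in>UNIV. \<Sum>j\<in>UNIV. (A $ i $ j)\<^sup>2)"
    by (simp add: frob_norm_eq sum_nonneg)
  also have "\<dots> = (\<Sum>j\<in>UNIV. \<Sum>i\<in>UNIV. (A $ i $ j)\<^sup>2)"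
    by (rule sum.swap)
  also have "\<dots> = (\<Sum>j\<in>UNIV. (norm (A *v axis j 1))\<^sup>2)"
    by (simp add: norm_vec_def L2_set_def sum_nonneg column_def matrix_vector_mul_component
        matrix_vector_mult_basis)
  finally show ?thesis .
qed

lemma norm_transpose: "norm (transpose A) = norm A" for A :: "real^'n^'m"
  unfolding frob_norm_eq by (subst sum.swap) (simp add: transpose_def)

lemma frob_mult_le_spectral_left: "norm (A ** B) \<le> spectral_norm A * norm B"
  for A :: "real^'n^'m" and B :: "real^'k^'n"
proof (rule power2_le_imp_le)
  have "(norm (A ** B))\<^sup>2 = (\<Sum>j\<in>UNIV. (norm (A *v (B *v axis j 1)))\<^sup>2)"
    by (simp add: frob_sq_columns matrix_vector_mul_assoc)
  also have "\<dots> \<le> (\<Sum>j\<in>UNIV. (spectral_norm A * norm (B *v axis j 1))\<^sup>2)"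
    by (intro sum_mono power_mono norm_matrix_vector_le_spectral norm_ge_zero)
  also have "\<dots> = (spectral_norm A * norm B)\<^sup>2"
    by (simp add: frob_sq_columns[of B] power_mult_distrib sum_distrib_left)
  finally show "(norm (A ** B))\<^sup>2 \<le> (spectral_norm A * norm B)\<^sup>2" .
qed (simp add: spectral_norm_nonneg)

text \<open>Moving one \<open>transpose A\<close> across the inner product bounds the square of
  \<open>norm ?w\<close> by a multiple of \<open>norm ?w\<close>, and one factor cancels.\<close>

lemma spectral_norm_transpose_le: "spectral_norm (transpose A) \<le> spectral_norm A"
  for A :: "real^'n^'m"
proof (rule spectral_norm_le)
  fix v :: "real^'m"
  let ?w = "transpose A *v v"
  have "norm ?w * norm ?w = v \<bullet> (A *v ?w)"
    using inner_matrix_transpose[of "transpose A" v ?w]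
    by (simp only: transpose_transpose power2_eq_square[symmetric] power2_norm_eq_inner)
  also have "\<dots> \<le> norm v * norm (A *v ?w)"
    by (rule norm_cauchy_schwarz)
  also have "\<dots> \<le> norm v * (spectral_norm A * norm ?w)"
    by (intro mult_left_mono norm_matrix_vector_le_spectral norm_ge_zero)
  finally show "norm ?w \<le> spectral_norm A * norm v"
    by (cases "norm ?w = 0") (auto simp: spectral_norm_nonneg mult_ac)
qed

lemma spectral_norm_transpose: "spectral_norm (transpose A) = spectral_norm A"
  for A :: "real^'n^'m"
  using spectral_norm_transpose_le[of A] spectral_norm_transpose_le[of "transpose A"] by simp

lemma frob_mult_le_spectral_right: "norm (A ** B) \<le> norm A * spectral_norm B"
  for A :: "real^'n^'m" and B :: "real^'k^'n"
  using frob_mult_le_spectral_left[of "transpose B" "transpose A"]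
  by (simp add: norm_transpose spectral_norm_transpose mult.commute flip: matrix_transpose_mul)

lemma spectral_norm_le_frob: "spectral_norm A \<le> norm A" for A :: "real^'n^'m"
proof (rule spectral_norm_le)
  fix v
  have "norm (A *v v) = L2_set (\<lambda>i. norm (A $ i \<bullet> v)) UNIV"
    by (simp add: norm_vec_def matrix_vector_mul_component)
  also have "\<dots> \<le> L2_set (\<lambda>i. norm (A $ i) * norm v) UNIV"
    by (rule L2_set_mono) (auto simp: Cauchy_Schwarz_ineq2)
  also have "\<dots> = norm A * norm v"
    by (simp add: norm_vec_def[of A] L2_set_left_distrib)
  finally show "norm (A *v v) \<le> norm A * norm v" .
qed

lemma norm_matrix_vector_le_frob: "norm (A *v v) \<le> norm A * norm v" for A :: "real^'n^'m"
  by (rule order_trans[OF norm_matrix_vector_le_spectral])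
     (intro mult_right_mono spectral_norm_le_frob norm_ge_zero)

lemma norm_matrix_vector_le_of_frob_le: "norm A \<le> c \<Longrightarrow> norm (A *v v) \<le> c * norm v"
  for A :: "real^'n^'m"
  by (meson mult_right_mono norm_ge_zero norm_matrix_vector_le_frob order_trans)

lemma frob_mult_le: "norm (A ** B) \<le> norm A * norm B"
  for A :: "real^'n^'m" and B :: "real^'k^'n"
  by (rule order_trans[OF frob_mult_le_spectral_left])
     (intro mult_right_mono spectral_norm_le_frob norm_ge_zero)

lemma frob_le_spectral: "norm A \<le> sqrt (real CARD('n)) * spectral_norm A" for A :: "real^'n^'m"
proof (rule power2_le_imp_le)
  have "(norm A)\<^sup>2 \<le> (\<Sum>j\<in>(UNIV::'n set). (spectral_norm A * 1)\<^sup>2)"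
    unfolding frob_sq_columns
    by (intro sum_mono power_mono norm_ge_zero)
       (metis norm_axis_1 norm_matrix_vector_le_spectral)
  then show "(norm A)\<^sup>2 \<le> (sqrt (real CARD('n)) * spectral_norm A)\<^sup>2"
    by (simp add: power_mult_distrib)
qed (simp add: spectral_norm_nonneg)

section \<open>Entrywise error bounds, traces, permutations and inverses\<close>

lemma frob_abs: "norm \<bar>A\<bar> = norm A" for A :: "real^'n^'m"
  by (simp add: frob_norm_eq abs_matrix_nth)

lemma frob_mono: "norm A \<le> norm B" if "\<bar>A\<bar> \<le> B" for A :: "real^'n^'m"
proof -
  have "\<bar>A $ i $ j\<bar> \<le> B $ i $ j" for i j
    using that by (auto simp: le_matrix_iff abs_matrix_nth)
  then show ?thesis
    unfolding frob_norm_eq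
    by (intro real_sqrt_le_mono sum_mono) (metis abs_ge_zero power2_abs power_mono)
qed

lemma frob_le_of_abs_le: "norm A \<le> c * norm B" if "\<bar>A\<bar> \<le> c *\<^sub>R \<bar>B\<bar>" "0 \<le> c"
  for A :: "real^'n^'m"
  using frob_mono[OF that(1)] that(2) by (simp add: frob_abs)

lemma frob_le_of_abs_le_mult:
  fixes A :: "real^'n^'m" and B :: "real^'k^'m"
  assumes "\<bar>A\<bar> \<le> c *\<^sub>R (\<bar>B\<bar> ** \<bar>C\<bar>)" "0 \<le> c"
  shows "norm A \<le> c * (norm B * norm C)"
proof -
  have "norm A \<le> c * norm (\<bar>B\<bar> ** \<bar>C\<bar>)"
    using frob_mono[OF assms(1)] assms(2) by simp
  also have "\<dots> \<le> c * (norm \<bar>B\<bar> * norm \<bar>C\<bar>)"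
    by (intro mult_left_mono frob_mult_le assms)
  finally show ?thesis by (simp add: frob_abs)
qed

lemma frob_sq_trace: "(norm A)\<^sup>2 = trace (transpose A ** A)" for A :: "real^'n^'m"
proof -
  have "(norm A)\<^sup>2 = (\<Sum>i\<in>UNIV. \<Sum>j\<in>UNIV. (A $ i $ j)\<^sup>2)"
    by (simp add: frob_norm_eq sum_nonneg)
  also have "\<dots> = (\<Sum>j\<in>UNIV. \<Sum>i\<in>UNIV. (A $ i $ j)\<^sup>2)"
    by (rule sum.swap)
  finally show ?thesis
    by (simp add: trace_def matrix_matrix_mult_def transpose_def power2_eq_square)
qed

text \<open>On the diagonal the bound is a multiple of the squared column norms of \<open>A\<close>,
  which sum to the squared Frobenius norm. Passing from the Frobenius norm of \<open>E\<close> to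
  its trace would cost a further factor sqrt n.\<close>

lemma trace_le_of_abs_le:
  fixes A :: "real^'n^'m"
  assumes "\<bar>E\<bar> \<le> c *\<^sub>R (\<bar>transpose A\<bar> ** \<bar>A\<bar>)"
  shows "trace E \<le> c * (norm A)\<^sup>2"
proof -
  have tr: "\<bar>transpose A\<bar> = transpose \<bar>A\<bar>"
    by (simp add: vec_eq_iff abs_matrix_nth transpose_def)
  have "trace E \<le> trace (c *\<^sub>R (transpose \<bar>A\<bar> ** \<bar>A\<bar>))"
    unfolding trace_def
  proof (rule sum_mono)
    fix i
    have "\<bar>E $ i $ i\<bar> \<le> (c *\<^sub>R (transpose \<bar>A\<bar> ** \<bar>A\<bar>)) $ i $ i"
      using assms unfolding le_matrix_iff abs_matrix_nth tr by blast
    then show "E $ i $ i \<le> (c *\<^sub>R (transpose \<bar>A\<bar> ** \<bar>A\<bar>)) $ i $ i" by linarith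
  qed
  also have "\<dots> = c * (norm \<bar>A\<bar>)\<^sup>2"
    by (simp add: frob_sq_trace trace_def sum_distrib_left)
  finally show ?thesis by (simp add: frob_abs)
qed

lemma norm_permutation_matrix: "norm (P *v x) = norm x" if P: "permutation_matrix P"
  for P :: "real^'s^'s"
proof -
  obtain \<pi> where \<pi>: "bij \<pi>" and P_eq: "P = (\<chi> i j. if j = \<pi> i then 1 else 0)"
    using P unfolding permutation_matrix_def by blast
  have "(P *v x) $ i = x $ \<pi> i" for i
    by (simp add: P_eq matrix_vector_mult_def if_distrib[of "\<lambda>t. t * _"] cong: if_cong)
  then have "(norm (P *v x))\<^sup>2 = (\<Sum>i\<in>UNIV. (x $ \<pi> i)\<^sup>2)"
    by (simp add: norm_vec_def L2_set_def sum_nonneg)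
  also have "\<dots> = (\<Sum>i\<in>UNIV. (x $ i)\<^sup>2)"
    using \<pi> by (intro sum.reindex_bij_betw) auto
  also have "\<dots> = (norm x)\<^sup>2"
    by (simp add: norm_vec_def L2_set_def sum_nonneg)
  finally show ?thesis by simp
qed

text \<open>The lower bound makes the kernel trivial, so the square matrix \<open>B\<close> has a
  two-sided inverse; the bound at \<open>C *v v\<close> then controls \<open>C\<close>.\<close>

lemma inverse_of_lower_bound:
  fixes B :: "real^'n^'n"
  assumes "0 < c" "\<And>v. c * norm v \<le> norm (B *v v)"
  obtains C where "B ** C = mat 1" "C ** B = mat 1" "spectral_norm C \<le> 1 / c"
proof -
  have "v = 0" if "B *v v = 0" for v
    using assms(2)[of v] \<open>0 < c\<close> that by (simp add: mult_le_0_iff)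
  then obtain C where C: "C ** B = mat 1" "B ** C = mat 1"
    by (metis matrix_left_invertible_ker matrix_left_right_inverse)
  have "spectral_norm C \<le> 1 / c"
  proof (rule spectral_norm_le)
    fix v
    have "c * norm (C *v v) \<le> norm v"
      using assms(2)[of "C *v v"] by (simp add: matrix_vector_mul_assoc C)
    then show "norm (C *v v) \<le> 1 / c * norm v"
      using \<open>0 < c\<close> by (simp add: field_simps)
  qed
  with C show ?thesis using that by blast
qed

text \<open>Minimality of the form at \<open>v\<close> is tested along the direction \<open>C v\<close>.\<close>

lemma psd_form_kernel:
  fixes C :: "real^'n^'n"
  assumes sym: "transpose C = C" and psd: "\<And>w. 0 \<le> w \<bullet> (C *v w)" and zero: "v \<bullet> (C *v v) = 0"
  shows "C *v v = 0"
proof -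
  let ?w = "C *v v"
  let ?q = "?w \<bullet> (C *v ?w)"
  \<comment> \<open>Adding 1 to \<open>?q\<close> keeps the denominator positive when the form
    vanishes at \<open>?w\<close>; for nonzero \<open>?w\<close> the form is still negative at
    \<open>v - t *\<^sub>R ?w\<close>.\<close>
  define t where "t = (?w \<bullet> ?w) / (?q + 1)"
  have q: "0 \<le> ?q" by (rule psd)
  have vw: "v \<bullet> (C *v ?w) = ?w \<bullet> ?w"
    by (metis inner_matrix_transpose sym)
  have "(v - t *\<^sub>R ?w) \<bullet> (C *v (v - t *\<^sub>R ?w)) = t * (t * ?q - 2 * (?w \<bullet> ?w))"
    by (simp add: matrix_vector_mult_diff_distrib matrix_vector_mult_scaleR inner_diff_left
        inner_diff_right vw zero algebra_simps)
  then have ge: "0 \<le> t * (t * ?q - 2 * (?w \<bullet> ?w))" by (metis psd)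
  show ?thesis
  proof (rule ccontr)
    assume "?w \<noteq> 0"
    then have pos: "0 < ?w \<bullet> ?w" by simp
    with q have "0 < t" by (simp add: t_def)
    have "t * (?q + 1) = ?w \<bullet> ?w" using q by (simp add: t_def)
    then have "t * ?q - 2 * (?w \<bullet> ?w) < 0"
      using pos \<open>0 < t\<close> by (simp only: distrib_left)
    with \<open>0 < t\<close> ge show False by (simp add: zero_le_mult_iff)
  qed
qed

section \<open>Singular values and their extremal characterization\<close>

text \<open>Eigenvectors of a symmetric matrix for distinct eigenvalues are orthogonal, hence
  independent, so there are only finitely many eigenvalues. \<open>Max\<close> and
  \<open>Min\<close> in \<open>sigma_max\<close> and \<open>sigma_min\<close> rely on this.\<close>

lemma singular_values_finite: "finite (singular_values A)" for A :: "real^'n^'m"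
proof -
  let ?C = "transpose A ** A"
  define E where "E = {\<mu>. \<exists>v. v \<noteq> 0 \<and> ?C *v v = \<mu> *\<^sub>R v}"
  have "\<forall>\<mu>\<in>E. \<exists>v. v \<noteq> 0 \<and> ?C *v v = \<mu> *\<^sub>R v"
    by (simp add: E_def)
  then have "\<exists>f. \<forall>\<mu>\<in>E. f \<mu> \<noteq> 0 \<and> ?C *v f \<mu> = \<mu> *\<^sub>R f \<mu>"
    by (rule bchoice)
  then obtain f where f: "\<forall>\<mu>\<in>E. f \<mu> \<noteq> 0 \<and> ?C *v f \<mu> = \<mu> *\<^sub>R f \<mu>" ..
  have inj: "inj_on f E"
  proof (rule inj_onI)
    fix \<mu> \<nu> assume "\<mu> \<in> E" "\<nu> \<in> E" "f \<mu> = f \<nu>"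
    then have "\<mu> *\<^sub>R f \<mu> = \<nu> *\<^sub>R f \<mu>" "f \<mu> \<noteq> 0"
      using f by metis+
    then show "\<mu> = \<nu>" by simp
  qed
  have sym: "transpose ?C = ?C"
    by (simp add: matrix_transpose_mul)
  have "f \<mu> \<bullet> f \<nu> = 0" if "\<mu> \<in> E" "\<nu> \<in> E" "\<mu> \<noteq> \<nu>" for \<mu> \<nu>
  proof -
    have "(?C *v f \<mu>) \<bullet> f \<nu> = f \<mu> \<bullet> (?C *v f \<nu>)"
      by (simp only: inner_matrix_transpose sym)
    then have "\<mu> * (f \<mu> \<bullet> f \<nu>) = \<nu> * (f \<mu> \<bullet> f \<nu>)"
      using f that by simp
    with that show ?thesis by simp
  qed
  then have "pairwise orthogonal (f ` E)"
    by (force simp: pairwise_def orthogonal_def)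
  moreover have "0 \<notin> f ` E" using f by force
  ultimately have "independent (f ` E)"
    by (rule pairwise_orthogonal_independent)
  then have "finite (f ` E)" by (rule independent_imp_finite)
  with inj have "finite E" by (metis finite_imageD)
  moreover have "singular_values A = sqrt ` E"
    unfolding singular_values_def E_def by blast
  ultimately show ?thesis by simp
qed

text \<open>\<open>sqrt\<close> is negative on negative reals, so \<open>0 \<le> \<mu>\<close> is
  read off the quadratic form of the Gram matrix at an eigenvector.\<close>

lemma singular_valuesE:
  fixes A :: "real^'n^'m"
  assumes "\<sigma> \<in> singular_values A"
  obtains v where "v \<noteq> 0" "norm (A *v v) = \<sigma> * norm v" "0 \<le> \<sigma>"
proof -
  obtain \<mu> v where \<mu>: "\<sigma> = sqrt \<mu>" "v \<noteq> 0" "(transpose A ** A) *v v = \<mu> *\<^sub>R v"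
    using assms unfolding singular_values_def by blast
  have "(norm (A *v v))\<^sup>2 = \<mu> * (norm v)\<^sup>2"
    unfolding norm_matrix_vector_sq \<mu> by (simp add: power2_norm_eq_inner)
  moreover from this have "0 \<le> \<mu>"
    using \<mu>(2) by (metis not_le mult_neg_pos zero_le_power2 zero_less_norm_iff zero_less_power)
  ultimately have "norm (A *v v) = \<sigma> * norm v"
    using \<mu>(1) by (metis norm_ge_zero real_sqrt_mult real_sqrt_unique)
  with \<mu> \<open>0 \<le> \<mu>\<close> show ?thesis using that by simp
qed

text \<open>If \<open>\<sigma>\<close> is an extremal stretch attained at \<open>v\<close>, the form
  of \<open>?C\<close> is semidefinite and vanishes at \<open>v\<close>, so
  \<open>psd_form_kernel\<close> makes \<open>v\<close> an eigenvector. For a maximum the form is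
  negated first.\<close>

lemma singular_valuesI:
  fixes A :: "real^'n^'m"
  assumes "norm v = 1" "norm (A *v v) = \<sigma>"
    and "(\<forall>w. norm (A *v w) \<le> \<sigma> * norm w) \<or> (\<forall>w. \<sigma> * norm w \<le> norm (A *v w))"
  shows "\<sigma> \<in> singular_values A"
proof -
  let ?B = "transpose A ** A"
  let ?C = "?B - mat (\<sigma>\<^sup>2)"
  have \<sigma>: "0 \<le> \<sigma>" using assms(2) by auto
  have mat: "mat c *v w = c *\<^sub>R w" for c :: real and w :: "real^'n"
    by (simp add: vec_eq_iff matrix_vector_mult_def mat_def if_distrib[of "\<lambda>t. t * _"] cong: if_cong)
  have C: "?C *v w = ?B *v w - \<sigma>\<^sup>2 *\<^sub>R w" for w
    by (simp add: matrix_vector_mult_diff_rdistrib mat)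
  have form: "w \<bullet> (?C *v w) = (norm (A *v w))\<^sup>2 - (\<sigma> * norm w)\<^sup>2" for w
    by (simp add: C inner_diff_right norm_matrix_vector_sq power_mult_distrib
        power2_norm_eq_inner[of w])
  have sym: "transpose ?C = ?C"
    by (simp add: vec_eq_iff transpose_def matrix_matrix_mult_def mat_def mult.commute)
  have neg: "(- ?C) *v w = - (?C *v w)" for w
    using matrix_vector_mult_diff_rdistrib[of 0 ?C w] by simp
  have zero: "v \<bullet> (?C *v v) = 0" using assms(1,2) by (simp add: form)
  have "?C *v v = 0"
    using assms(3)
  proof
    assume "\<forall>w. norm (A *v w) \<le> \<sigma> * norm w"
    then have "0 \<le> w \<bullet> ((- ?C) *v w)" for w
      using power_mono[of "norm (A *v w)" "\<sigma> * norm w" 2]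
      by (simp add: neg form del: minus_diff_eq)
    moreover have "transpose (- ?C) = - ?C"
      by (subst (2) sym[symmetric])
         (simp only: vec_eq_iff transpose_def vec_lambda_beta vector_uminus_component simp_thms)
    moreover have "v \<bullet> ((- ?C) *v v) = 0"
      using zero by (simp only: neg inner_minus_right)
    ultimately have "(- ?C) *v v = 0" by (intro psd_form_kernel)
    then show ?thesis by (simp only: neg neg_equal_0_iff_equal)
  next
    assume "\<forall>w. \<sigma> * norm w \<le> norm (A *v w)"
    then have "0 \<le> w \<bullet> (?C *v w)" for w
      using form[of w] power_mono[of "\<sigma> * norm w" "norm (A *v w)" 2] \<sigma> by simp
    with sym zero show ?thesis by (intro psd_form_kernel)
  qed
  then have "?B *v v = \<sigma>\<^sup>2 *\<^sub>R v" by (simp add: C)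
  moreover have "v \<noteq> 0" using assms(1) by auto
  moreover have "\<sigma> = sqrt (\<sigma>\<^sup>2)" using \<sigma> by simp
  ultimately show ?thesis unfolding singular_values_def by blast
qed

text \<open>Homogeneity; the abstract \<open>P\<close> serves both the minimum and the maximum over
  the unit sphere.\<close>

lemma unit_vector_scaling:
  fixes A :: "real^'n^'m"
  assumes "\<And>v. norm v = 1 \<Longrightarrow> P (norm (A *v v))"
  shows "w \<noteq> 0 \<Longrightarrow> P (norm (A *v w) / norm w)"
  using assms[of "inverse (norm w) *\<^sub>R w"]
  by (simp add: matrix_vector_mult_scaleR divide_inverse mult.commute)

text \<open>By compactness the unit sphere carries a least and a greatest stretch. Both are singular
  values, and every singular value is the stretch of some vector, hence lies between them.\<close>

lemma extremal_singular_values: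
  fixes A :: "real^'n^'m"
  shows sigma_min_le: "sigma_min A * norm w \<le> norm (A *v w)"
    and sigma_min_nonneg: "0 \<le> sigma_min A"
    and sigma_max_eq: "sigma_max A = spectral_norm A"
    and sigma_min_le_spectral_norm: "sigma_min A \<le> spectral_norm A"
proof -
  let ?S = "sphere (0::real^'n) 1"
  have cont: "continuous_on ?S (\<lambda>v. norm (A *v v))"
    by (intro continuous_intros linear_continuous_on matrix_vector_mul_bounded_linear)
  have ne: "?S \<noteq> {}" by (metis empty_iff mem_sphere_0 norm_axis_1)
  obtain v where v: "norm v = 1" "\<And>w. norm w = 1 \<Longrightarrow> norm (A *v v) \<le> norm (A *v w)"
    using continuous_attains_inf[OF compact_sphere ne cont] by auto
  obtain z where z: "norm z = 1" "\<And>w. norm w = 1 \<Longrightarrow> norm (A *v w) \<le> norm (A *v z)"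
    using continuous_attains_sup[OF compact_sphere ne cont] by auto
  have lower: "norm (A *v v) * norm w \<le> norm (A *v w)" for w
    using unit_vector_scaling[of "\<lambda>t. norm (A *v v) \<le> t" A w] v
    by (cases "w = 0") (auto simp: field_simps)
  have upper: "norm (A *v w) \<le> norm (A *v z) * norm w" for w
    using unit_vector_scaling[of "\<lambda>t. t \<le> norm (A *v z)" A w] z
    by (cases "w = 0") (auto simp: field_simps)
  have vin: "norm (A *v v) \<in> singular_values A"
    using v lower by (intro singular_valuesI) auto
  have zin: "norm (A *v z) \<in> singular_values A"
    using z upper by (intro singular_valuesI) auto
  have bounds: "norm (A *v v) \<le> \<sigma> \<and> \<sigma> \<le> norm (A *v z)" if \<sigma>: "\<sigma> \<in> singular_values A" for \<sigma>
  proof -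
    obtain y where "y \<noteq> 0" "norm (A *v y) = \<sigma> * norm y"
      using singular_valuesE[OF \<sigma>] by blast
    then show ?thesis
      by (metis lower upper mult_le_cancel_right_pos zero_less_norm_iff)
  qed
  have min: "sigma_min A = norm (A *v v)"
    unfolding sigma_min_def using bounds by (intro Min_eqI singular_values_finite vin) blast
  have max: "sigma_max A = norm (A *v z)"
    unfolding sigma_max_def using bounds by (intro Max_eqI singular_values_finite zin) blast
  show "sigma_min A * norm w \<le> norm (A *v w)" "0 \<le> sigma_min A"
    using lower by (auto simp: min)
  have "spectral_norm A \<le> norm (A *v z)" by (rule spectral_norm_le) (rule upper)
  moreover have "norm (A *v z) \<le> spectral_norm A"
    using norm_matrix_vector_le_spectral[of A z] z(1) by simp
  ultimately show "sigma_max A = spectral_norm A" by (simp add: max)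
  show "sigma_min A \<le> spectral_norm A"
    using norm_matrix_vector_le_spectral[of A v] v(1) by (simp add: min)
qed

section \<open>One Cholesky QR step\<close>

lemma matrix_mult_diff_right: "A ** (B - C) = A ** B - A ** C"
  for A :: "real^'n^'m" and B :: "real^'k^'n"
  by (simp add: vec_eq_iff matrix_matrix_mult_def sum_subtractf algebra_simps)

lemma matrix_mult_diff_left: "(A - B) ** C = A ** C - B ** C"
  for A :: "real^'n^'m" and C :: "real^'k^'n"
  by (simp add: vec_eq_iff matrix_matrix_mult_def sum_subtractf algebra_simps)

lemma matrix_add_rdistrib: "(A + B) ** C = A ** C + B ** C"
  for A :: "real^'n^'m" and C :: "real^'k^'n"
  by (simp add: vec_eq_iff matrix_matrix_mult_def sum.distrib algebra_simps)

lemma transpose_add: "transpose (A + B) = transpose A + transpose B" for A :: "real^'n^'m"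
  by (simp add: vec_eq_iff transpose_def)

lemma gram_diff_norm_sq:
  "(norm (B *v v))\<^sup>2 - (norm (A *v v))\<^sup>2 = v \<bullet> ((transpose B ** B - transpose A ** A) *v v)"
  for A :: "real^'n^'m" and B :: "real^'n^'k"
  by (simp only: norm_matrix_vector_sq matrix_vector_mult_diff_rdistrib inner_diff_right)

text \<open>The numbers of rows may differ, so that a tall matrix can be compared with its
  triangular factor or with the identity.\<close>

lemma gram_diff_le:
  fixes A :: "real^'n^'m" and B :: "real^'n^'k"
  assumes "norm (transpose B ** B - transpose A ** A) \<le> \<delta>"
  shows "\<bar>(norm (B *v v))\<^sup>2 - (norm (A *v v))\<^sup>2\<bar> \<le> \<delta> * (norm v)\<^sup>2"
proof -
  let ?D = "transpose B ** B - transpose A ** A"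
  have "\<bar>v \<bullet> (?D *v v)\<bar> \<le> norm v * (norm ?D * norm v)"
    by (rule order_trans[OF Cauchy_Schwarz_ineq2])
       (intro mult_left_mono norm_matrix_vector_le_frob norm_ge_zero)
  also have "\<dots> \<le> norm v * (\<delta> * norm v)"
    by (intro mult_left_mono mult_right_mono assms norm_ge_zero)
  finally show ?thesis
    by (simp only: gram_diff_norm_sq) (simp add: power2_eq_square mult_ac)
qed

text \<open>\<open>a\<close> and \<open>b\<close> are rational substitutes for sqrt(1 - \<eta>) and
  sqrt(1 + \<eta>), which reduces each use to arithmetic with fractions. Where only one bound is
  wanted, the other constant gets a crude value, \<open>a = 0\<close> or
  \<open>b = 2\<close>.\<close>

lemma near_orthonormal_bounds:
  fixes Q :: "real^'n^'m"
  assumes orth: "norm (transpose Q ** Q - mat 1) \<le> \<eta>"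
    and a: "0 \<le> a" "a\<^sup>2 \<le> 1 - \<eta>" and b: "0 \<le> b" "1 + \<eta> \<le> b\<^sup>2"
  shows "a * norm v \<le> norm (Q *v v)" "norm (Q *v v) \<le> b * norm v"
proof -
  have "norm (transpose Q ** Q - transpose (mat 1 :: real^'n^'n) ** mat 1) \<le> \<eta>"
    using orth by simp
  from gram_diff_le[OF this, of v]
  have *: "\<bar>(norm (Q *v v))\<^sup>2 - (norm v)\<^sup>2\<bar> \<le> \<eta> * (norm v)\<^sup>2" by simp
  have "a\<^sup>2 * (norm v)\<^sup>2 \<le> (1 - \<eta>) * (norm v)\<^sup>2" "(1 + \<eta>) * (norm v)\<^sup>2 \<le> b\<^sup>2 * (norm v)\<^sup>2"
    by (intro mult_right_mono a b zero_le_power2)+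
  with * have "(a * norm v)\<^sup>2 \<le> (norm (Q *v v))\<^sup>2" "(norm (Q *v v))\<^sup>2 \<le> (b * norm v)\<^sup>2"
    unfolding power_mult_distrib by (simp_all add: algebra_simps abs_le_iff)
  then show "a * norm v \<le> norm (Q *v v)" "norm (Q *v v) \<le> b * norm v"
    using a b by (auto intro: power2_le_imp_le)
qed

lemma frob_le_of_bound: "norm A \<le> sqrt (real CARD('n)) * b"
  if "\<And>v. norm (A *v v) \<le> b * norm v" for A :: "real^'n^'m"
  by (rule order_trans[OF frob_le_spectral])
     (intro mult_left_mono spectral_norm_le that real_sqrt_ge_zero of_nat_0_le_iff)

text \<open>
  The constant \<open>51/50\<close> is the 1.02 of the rounding error model, and \<open>b/a\<close> bounds the condition number
  of \<open>A\<close>. With \<open>D = R\<^sup>T R - A\<^sup>T A\<close> the backward error of the factorization and \<open>F = B R - A\<close>, the defect of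
  \<open>B = A R\<^sup>-\<^sup>1 + F R\<^sup>-\<^sup>1\<close> is \<open>-R\<^sup>-\<^sup>T D R\<^sup>-\<^sup>1\<close> up to the terms with \<open>F R\<^sup>-\<^sup>1\<close>. The bound on \<open>R\<close> needed for \<open>D\<close> is read
  off the trace of \<open>R\<^sup>T R\<close>, which avoids a circular argument.
\<close>

lemma cholesky_qr_step:
  fixes A B :: "real^'n^'m" and R G :: "real^'n^'n" and a b m n u T :: real
  assumes m_def: "m = real CARD('m)" and n_def: "n = real CARD('n)"
    and u: "0 \<le> u" and T: "T = m * n * u + n * (n + 1) * u" "T \<le> 23 / 5000" "T * b\<^sup>2 \<le> a\<^sup>2 / 64"
    and a: "0 < a" and lower: "\<And>v. a * norm v \<le> norm (A *v v)"
    and upper: "\<And>v. norm (A *v v) \<le> b * norm v"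
    and E1: "\<bar>G - transpose A ** A\<bar> \<le> (51 / 50 * m * u) *\<^sub>R (\<bar>transpose A\<bar> ** \<bar>A\<bar>)"
    and E2: "\<bar>transpose R ** R - G\<bar> \<le> (51 / 50 * (n + 1) * u) *\<^sub>R (\<bar>transpose R\<bar> ** \<bar>R\<bar>)"
    and E3: "\<bar>B ** R - A\<bar> \<le> (51 / 50 * n * u) *\<^sub>R (\<bar>B\<bar> ** \<bar>R\<bar>)"
  shows "norm (transpose B ** B - mat 1) \<le> 321 / 100 * (T * (b / a)\<^sup>2)"
    and "norm R \<le> 201 / 200 * (sqrt n * b)"
    and "norm (R *v v) \<le> 201 / 200 * b * norm v"
proof -
  define N where "N = sqrt n"
  define K where "K = b / a"
  have m1: "1 \<le> m" and n1: "1 \<le> n" unfolding m_def n_def by (simp_all add: Suc_leI)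
  have N1: "1 \<le> N" and N2: "N\<^sup>2 = n" using n1 by (simp_all add: N_def)
  then have NN: "N * N = n" by (simp add: power2_eq_square)
  have "N * 1 \<le> N * N" by (intro mult_left_mono) (use N1 in auto)
  then have Nn: "N \<le> n" using NN by simp
  \<comment> \<open>Any unit vector yields \<open>a \<le> b\<close>; a basis vector at an arbitrary
    index serves.\<close>
  have "a * norm (axis undefined 1 :: real^'n) \<le> b * norm (axis undefined 1 :: real^'n)"
    using lower upper by (rule order_trans)
  then have "a \<le> b" by simp
  with a have b: "0 < b" and K1: "1 \<le> K" by (auto simp: K_def)
  have T0: "0 \<le> T" using T(1) u m1 n1 by simp
  have nnuT: "n * n * u \<le> T" and n1uT: "(n + 1) * u \<le> T" and muT: "m * u \<le> T"
  proof -
    have "1 * ((n + 1) * u) \<le> n * ((n + 1) * u)" "1 * (m * u) \<le> n * (m * u)"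
      by (rule mult_right_mono; use n1 m1 u in simp)+
    moreover have "0 \<le> m * n * u" "0 \<le> n * (n + 1) * u" "0 \<le> n * u"
      using n1 m1 u by auto
    ultimately show "n * n * u \<le> T" "(n + 1) * u \<le> T" "m * u \<le> T"
      unfolding T(1) by (auto simp: algebra_simps)
  qed
  have TK2: "T * K\<^sup>2 \<le> 1 / 64"
    using T(3) a by (simp add: K_def power_divide field_simps)
  have "T * (K * 1) \<le> T * (K * K)"
    using T0 K1 by (intro mult_left_mono) auto
  then have TK_le: "T * K \<le> T * K\<^sup>2" by (simp add: power2_eq_square)
  have nA: "norm A \<le> N * b"
    unfolding N_def n_def using upper by (rule frob_le_of_bound)
  then have nA2: "(norm A)\<^sup>2 \<le> n * b\<^sup>2"
    using power_mono[OF nA norm_ge_zero, of 2] N2 by (simp add: power_mult_distrib)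

  define D where "D = transpose R ** R - transpose A ** A"
  have D_split: "D = (G - transpose A ** A) + (transpose R ** R - G)" by (simp add: D_def)
  \<comment> \<open>As 1.02 * 0.0046 < 0.0047, the traces give 0.9953 times the square of
    \<open>norm R\<close> at most 1.0047 times that of \<open>norm A\<close>; the ratio is below
    1.0095.\<close>
  have "(norm R)\<^sup>2 \<le> 2019 / 2000 * (norm A)\<^sup>2"
  proof -
    have "(norm R)\<^sup>2 - (norm A)\<^sup>2 = trace (G - transpose A ** A) + trace (transpose R ** R - G)"
      by (simp add: frob_sq_trace trace_sub)
    also have "\<dots> \<le> (51 / 50 * m * u) * (norm A)\<^sup>2 + (51 / 50 * (n + 1) * u) * (norm R)\<^sup>2"
      by (intro add_mono trace_le_of_abs_le E1 E2)
    also have "\<dots> \<le> 47 / 10000 * (norm A)\<^sup>2 + 47 / 10000 * (norm R)\<^sup>2"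
    proof (intro add_mono mult_right_mono zero_le_power2)
      show "51 / 50 * m * u \<le> 47 / 10000" using muT T(2) by simp
      have "51 / 50 * (n + 1) * u = 51 / 50 * ((n + 1) * u)" by simp
      also have "\<dots> \<le> 47 / 10000" using n1uT T(2) by linarith
      finally show "51 / 50 * (n + 1) * u \<le> 47 / 10000" .
    qed
    finally show ?thesis using zero_le_power2[of "norm A"] by linarith
  qed
  with nA2 have nR2': "(norm R)\<^sup>2 \<le> 2019 / 2000 * (n * b\<^sup>2)" by simp
  also have "\<dots> \<le> (201 / 200 * (N * b))\<^sup>2"
    using n1 by (simp add: power_mult_distrib power_divide N2)
  finally have nR: "norm R \<le> 201 / 200 * (N * b)"
    by (rule power2_le_imp_le) (use N1 b in auto)
  then show "norm R \<le> 201 / 200 * (sqrt n * b)" by (simp add: N_def)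

  have nD: "norm D \<le> 103 / 100 * (T * b\<^sup>2)"
  proof -
    have c: "0 \<le> 51 / 50 * m * u" "0 \<le> 51 / 50 * (n + 1) * u" using m1 n1 u by auto
    have "norm D \<le> 51 / 50 * m * u * (norm (transpose A) * norm A)
        + 51 / 50 * (n + 1) * u * (norm (transpose R) * norm R)"
      unfolding D_split
      by (rule order_trans[OF norm_triangle_ineq])
         (intro add_mono frob_le_of_abs_le_mult[OF E1] frob_le_of_abs_le_mult[OF E2] c)
    also have "\<dots> = 51 / 50 * m * u * (norm A)\<^sup>2 + 51 / 50 * (n + 1) * u * (norm R)\<^sup>2"
      by (simp add: norm_transpose power2_eq_square)
    also have "\<dots> \<le> 51 / 50 * m * u * (n * b\<^sup>2) + 51 / 50 * (n + 1) * u * (2019 / 2000 * (n * b\<^sup>2))"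
      by (intro add_mono mult_left_mono nA2 nR2' c)
    also have "\<dots> = (51 / 50 * (m * n * u) + 51 / 50 * (2019 / 2000) * (n * (n + 1) * u)) * b\<^sup>2"
      by (simp add: algebra_simps)
    also have "\<dots> \<le> (103 / 100 * T) * b\<^sup>2"
    proof (rule mult_right_mono)
      have "51 / 50 * x + 51 / 50 * (2019 / 2000) * y \<le> 103 / 100 * (x + y)"
        if "0 \<le> x" "0 \<le> y" for x y :: real
        using that by simp
      then show "51 / 50 * (m * n * u) + 51 / 50 * (2019 / 2000) * (n * (n + 1) * u) \<le> 103 / 100 * T"
        using m1 n1 u unfolding T(1) by simp
    qed simp
    finally show ?thesis by simp
  qed
  have D_form: "(norm (R *v v))\<^sup>2 \<le> (norm (A *v v))\<^sup>2 + 103 / 100 * (T * b\<^sup>2 * (norm v)\<^sup>2)"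
    "(norm (A *v v))\<^sup>2 \<le> (norm (R *v v))\<^sup>2 + 103 / 100 * (T * b\<^sup>2 * (norm v)\<^sup>2)" for v
    using gram_diff_le[OF nD[unfolded D_def], of v]
    unfolding mult.assoc by linarith+
  show "norm (R *v v) \<le> 201 / 200 * b * norm v" for v
  proof (rule power2_le_imp_le)
    have "(norm (R *v v))\<^sup>2 \<le> (b * norm v)\<^sup>2 + 103 / 100 * (T * (b * norm v)\<^sup>2)"
      using D_form(1)[of v] power_mono[OF upper[of v] norm_ge_zero, of 2]
      by (simp add: power_mult_distrib mult_ac)
    also have "\<dots> \<le> (b * norm v)\<^sup>2 + 103 / 100 * (23 / 5000 * (b * norm v)\<^sup>2)"
      using T(2) by (intro add_mono mult_left_mono mult_right_mono) auto
    also have "\<dots> \<le> (201 / 200)\<^sup>2 * (b * norm v)\<^sup>2"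
      using zero_le_power2[of "b * norm v"] by (simp add: power_divide)
    finally show "(norm (R *v v))\<^sup>2 \<le> (201 / 200 * b * norm v)\<^sup>2"
      by (simp only: power_mult_distrib mult.assoc)
  qed (use b in auto)

  have Tb: "T * b\<^sup>2 * (norm v)\<^sup>2 \<le> (a * norm v)\<^sup>2 / 64" for v :: "real^'n"
    using mult_right_mono[OF T(3), of "(norm v)\<^sup>2"] by (simp add: power_mult_distrib)
  \<comment> \<open>0.9919 squared is just below 1 - 1.03/64, the share of
    \<open>(a * norm v)\<^sup>2\<close> that the backward error \<open>D\<close> leaves.\<close>
  have R_lower: "9919 / 10000 * a * norm v \<le> norm (R *v v)" for v
  proof (rule power2_le_imp_le)
    have "(a * norm v)\<^sup>2 \<le> (norm (A *v v))\<^sup>2"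
      using a by (intro power_mono lower) auto
    with D_form(2)[of v] Tb[of v] have "(1 - 103 / 6400) * (a * norm v)\<^sup>2 \<le> (norm (R *v v))\<^sup>2"
      by simp
    moreover have "(9919 / 10000)\<^sup>2 * (a * norm v)\<^sup>2 \<le> (1 - 103 / 6400) * (a * norm v)\<^sup>2"
      by (intro mult_right_mono) (auto simp: power_divide)
    ultimately show "(9919 / 10000 * a * norm v)\<^sup>2 \<le> (norm (R *v v))\<^sup>2"
      by (simp only: power_mult_distrib mult.assoc)
  qed simp
  obtain C where C: "R ** C = mat 1" "C ** R = mat 1" and sC: "spectral_norm C \<le> 1 / (9919 / 10000 * a)"
    using inverse_of_lower_bound[of "9919 / 10000 * a" R] a R_lower by auto
  have sC0: "0 \<le> spectral_norm C" by (rule spectral_norm_nonneg)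

  have AC: "norm ((A ** C) *v w) \<le> 5041 / 5000 * norm w" for w
  proof (rule power2_le_imp_le)
    let ?v = "C *v w"
    have Rv: "R *v ?v = w" by (simp add: matrix_vector_mul_assoc C)
    have "9919 / 10000 * a * norm ?v \<le> norm w" using R_lower[of ?v] by (simp add: Rv)
    then have "(9919 / 10000 * a * norm ?v)\<^sup>2 \<le> (norm w)\<^sup>2"
      using a by (intro power_mono) auto
    then have "(a * norm ?v)\<^sup>2 \<le> (norm w)\<^sup>2 / (9919 / 10000)\<^sup>2"
      by (simp add: power_mult_distrib power_divide field_simps)
    then have "(norm (A *v ?v))\<^sup>2 \<le> (1 + 103 / 6400 / (9919 / 10000)\<^sup>2) * (norm w)\<^sup>2"
      using D_form(2)[of ?v] Tb[of ?v] by (simp add: Rv power_divide)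
    also have "\<dots> \<le> (5041 / 5000)\<^sup>2 * (norm w)\<^sup>2"
      by (intro mult_right_mono) (auto simp: power_divide)
    finally show "(norm ((A ** C) *v w))\<^sup>2 \<le> (5041 / 5000 * norm w)\<^sup>2"
      by (simp only: power_mult_distrib matrix_vector_mul_assoc)
  qed simp
  have nAC: "norm (A ** C) \<le> N * (5041 / 5000)"
    unfolding N_def n_def using AC by (rule frob_le_of_bound)
  have sAC: "spectral_norm (A ** C) \<le> 5041 / 5000"
    using AC by (rule spectral_norm_le)

  define F where "F = B ** R - A"
  have B_eq: "B = A ** C + F ** C"
    by (simp add: F_def matrix_mult_diff_left C flip: matrix_mul_assoc)
  \<comment> \<open>The model measures the residual of the solve against the computed
    \<open>B\<close>, so \<open>norm B\<close> appears on the right. Its coefficient is below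
    1.034/64, which lets \<open>nB\<close> absorb that term.\<close>
  have nFC: "norm (F ** C) \<le> 51 / 50 * (201 / 200) / (9919 / 10000) * (n * N * u * K) * norm B"
  proof -
    have c: "0 \<le> 51 / 50 * n * u" using n1 u by auto
    have "norm (F ** C) \<le> norm F * spectral_norm C" by (rule frob_mult_le_spectral_right)
    also have "\<dots> \<le> (51 / 50 * n * u * (norm B * norm R)) * (1 / (9919 / 10000 * a))"
      unfolding F_def
      by (intro mult_mono frob_le_of_abs_le_mult[OF E3] sC c sC0 mult_nonneg_nonneg norm_ge_zero)
    also have "\<dots> \<le> (51 / 50 * n * u * (norm B * (201 / 200 * (N * b)))) * (1 / (9919 / 10000 * a))"
      using a by (intro mult_right_mono mult_left_mono nR c) auto
    also have "\<dots> = 51 / 50 * (201 / 200) / (9919 / 10000) * (n * N * u * K) * norm B"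
      using a by (simp add: K_def)
    finally show ?thesis .
  qed
  have nNuK: "n * N * u * K \<le> 1 / 64"
  proof -
    have "n * N * u * K \<le> n * n * u * K"
      using Nn n1 u K1 by (intro mult_right_mono mult_left_mono) auto
    also have "\<dots> \<le> T * K" using nnuT K1 by (intro mult_right_mono) auto
    finally show ?thesis using TK_le TK2 by simp
  qed
  have nB: "norm B \<le> 1281 / 1250 * N"
  proof -
    have "norm B \<le> norm (A ** C) + norm (F ** C)"
      by (subst B_eq) (rule norm_triangle_ineq)
    also have "\<dots> \<le> N * (5041 / 5000) + 51 / 50 * (201 / 200) / (9919 / 10000) * (1 / 64) * norm B"
      by (intro add_mono nAC order_trans[OF nFC] mult_right_mono mult_left_mono nNuK) auto
    finally show ?thesis using N1 by simp
  qed
  have FC: "norm (F ** C) \<le> 662 / 625 * (T * K)"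
  proof -
    have "norm (F ** C) \<le> 51 / 50 * (201 / 200) / (9919 / 10000) * (n * N * u * K) * (1281 / 1250 * N)"
      using n1 N1 u K1 by (intro order_trans[OF nFC] mult_left_mono nB) auto
    also have "\<dots> = 51 / 50 * (201 / 200) / (9919 / 10000) * (1281 / 1250) * (n * n * u * K)"
      by (simp flip: NN)
    also have "\<dots> \<le> 51 / 50 * (201 / 200) / (9919 / 10000) * (1281 / 1250) * (T * K)"
      using K1 by (intro mult_left_mono mult_right_mono nnuT) auto
    also have "\<dots> \<le> 662 / 625 * (T * K)"
      using T0 K1 by (intro mult_right_mono) auto
    finally show ?thesis .
  qed

  \<comment> \<open>\<open>R ** C = mat 1\<close> and the definition of \<open>D\<close> turn the
    Gram matrix of \<open>A ** C\<close> into \<open>mat 1 - transpose C ** D ** C\<close>; the rest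
    is the expansion of \<open>B = A ** C + F ** C\<close>.\<close>
  have gram: "transpose B ** B - mat 1
      = transpose (A ** C) ** (F ** C) + transpose (F ** C) ** (A ** C)
        + transpose (F ** C) ** (F ** C) - transpose C ** D ** C"
  proof -
    have "transpose C ** D ** C = transpose (R ** C) ** (R ** C) - transpose (A ** C) ** (A ** C)"
      unfolding D_def by (simp add: matrix_mult_diff_left matrix_mult_diff_right matrix_transpose_mul matrix_mul_assoc)
    then have "transpose C ** D ** C = mat 1 - transpose (A ** C) ** (A ** C)"
      by (simp add: C)
    then show ?thesis
      by (subst (1 2) B_eq)
         (simp add: transpose_add matrix_add_ldistrib matrix_add_rdistrib)
  qed
  have CDC: "norm (transpose C ** D ** C) \<le> 1047 / 1000 * (T * K\<^sup>2)"
  proof -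
    have "norm (transpose C ** D ** C) \<le> norm (transpose C ** D) * spectral_norm C"
      by (rule frob_mult_le_spectral_right)
    also have "\<dots> \<le> (spectral_norm C * norm D) * spectral_norm C"
      using frob_mult_le_spectral_left[of "transpose C" D]
      by (intro mult_right_mono sC0) (simp add: spectral_norm_transpose)
    also have "\<dots> \<le> (1 / (9919 / 10000 * a) * (103 / 100 * (T * b\<^sup>2))) * (1 / (9919 / 10000 * a))"
      using a T0 by (intro mult_mono sC nD mult_nonneg_nonneg sC0 norm_ge_zero) auto
    also have "\<dots> = 103 / 100 / (9919 / 10000) / (9919 / 10000) * (T * K\<^sup>2)"
      using a by (simp add: K_def power_divide power2_eq_square)
    also have "\<dots> \<le> 1047 / 1000 * (T * K\<^sup>2)"
      using T0 by (intro mult_right_mono) auto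
    finally show ?thesis .
  qed
  have "norm (transpose B ** B - mat 1) \<le> norm (transpose (A ** C) ** (F ** C))
      + norm (transpose (F ** C) ** (A ** C)) + norm (transpose (F ** C) ** (F ** C))
      + norm (transpose C ** D ** C)"
    unfolding gram by (smt (verit) norm_triangle_ineq norm_triangle_ineq4)
  also have "\<dots> \<le> 5041 / 5000 * norm (F ** C) + norm (F ** C) * (5041 / 5000) + norm (F ** C) * norm (F ** C)
      + 1047 / 1000 * (T * K\<^sup>2)"
  proof (intro add_mono CDC)
    show "norm (transpose (A ** C) ** (F ** C)) \<le> 5041 / 5000 * norm (F ** C)"
      by (rule order_trans[OF frob_mult_le_spectral_left])
         (unfold spectral_norm_transpose, intro mult_right_mono sAC norm_ge_zero)
    show "norm (transpose (F ** C) ** (A ** C)) \<le> norm (F ** C) * (5041 / 5000)"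
      by (rule order_trans[OF frob_mult_le_spectral_right])
         (unfold norm_transpose, intro mult_left_mono sAC norm_ge_zero)
    show "norm (transpose (F ** C) ** (F ** C)) \<le> norm (F ** C) * norm (F ** C)"
      by (rule order_trans[OF frob_mult_le]) (simp add: norm_transpose)
  qed
  also have "\<dots> \<le> 5041 / 5000 * (662 / 625 * (T * K)) + 662 / 625 * (T * K) * (5041 / 5000)
      + 662 / 625 * (T * K) * (662 / 625 * (T * K)) + 1047 / 1000 * (T * K\<^sup>2)"
    using T0 K1 by (intro add_mono mult_mono FC order_refl mult_nonneg_nonneg norm_ge_zero) auto
  also have "\<dots> \<le> 321 / 100 * (T * K\<^sup>2)"
  proof -
    \<comment> \<open>The quadratic term is small since \<open>T \<le> 23 / 5000\<close>, the linear
      ones use \<open>T * K \<le> T * K\<^sup>2\<close>; the coefficients add up to about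
      3.19.\<close>
    have "(T * K) * (T * K) = T * (T * K\<^sup>2)" by (simp add: power2_eq_square)
    also have "\<dots> \<le> 23 / 5000 * (T * K\<^sup>2)" using T0 T(2) by (intro mult_right_mono) auto
    finally have "(T * K) * (T * K) \<le> 23 / 5000 * (T * K\<^sup>2)" .
    moreover have lin: "5041 / 5000 * (662 / 625 * x) + 662 / 625 * x * (5041 / 5000)
        + 662 / 625 * x * (662 / 625 * x) + 1047 / 1000 * y \<le> 321 / 100 * y"
      if "x * x \<le> 23 / 5000 * y" "x \<le> y" "0 \<le> x" for x y :: real
      using that by simp
    ultimately show ?thesis using TK_le T0 K1 by (intro lin) simp_all
  qed
  finally show "norm (transpose B ** B - mat 1) \<le> 321 / 100 * (T * (b / a)\<^sup>2)"
    by (simp add: K_def)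
qed

section \<open>The sketched preconditioner\<close>

text \<open>Column by column. It bounds a right factor by the product without inverting the left
  one.\<close>

lemma frob_mult_ge:
  fixes A :: "real^'n^'m" and B :: "real^'k^'n"
  assumes "0 \<le> c" "\<And>v. c * norm v \<le> norm (A *v v)"
  shows "c * norm B \<le> norm (A ** B)"
proof (rule power2_le_imp_le)
  have "(c * norm B)\<^sup>2 = (\<Sum>j\<in>UNIV. (c * norm (B *v axis j 1))\<^sup>2)"
    by (simp add: frob_sq_columns power_mult_distrib sum_distrib_left)
  also have "\<dots> \<le> (\<Sum>j\<in>UNIV. (norm (A *v (B *v axis j 1)))\<^sup>2)"
    using assms by (intro sum_mono power_mono) auto
  also have "\<dots> = (norm (A ** B))\<^sup>2"
    by (simp add: frob_sq_columns matrix_vector_mul_assoc)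
  finally show "(c * norm B)\<^sup>2 \<le> (norm (A ** B))\<^sup>2" .
qed simp

text \<open>
  \<open>e\<close> is the lower distortion \<open>\<surd>(1 - \<epsilon>)\<close> of the sketch, \<open>\<mu>\<close> and \<open>\<nu>\<close> are the smallest singular values
  of the LU factors. The factor \<open>e - k\<close> enters because \<open>\<parallel>X\<parallel>\<^sub>2 (e - k)\<close> is what \<open>M N\<close> bounds.
\<close>

lemma sketch_preconditioner:
  fixes X :: "real^'n^'m" and S :: "real^'m^'s" and P :: "real^'s^'s"
    and Xs M Qs :: "real^'n^'s" and R\<^sub>0 R\<^sub>1 N :: "real^'n^'n"
    and u e k \<mu> \<nu> n s :: real
  assumes n_def: "n = real CARD('n)"
    and u: "0 \<le> u" and s: "0 \<le> s" and nnu: "n * n * u \<le> 23 / 5000" and snu: "s * n * u \<le> 1 / 64"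
    and P: "permutation_matrix P"
    and Eb: "\<bar>P ** Xs - M ** N\<bar> \<le> (51 / 50 * n * u) *\<^sub>R (\<bar>M\<bar> ** \<bar>N\<bar>)"
    and Ec: "\<bar>M - Qs ** R\<^sub>0\<bar> \<le> (51 / 50 * s * n * u) *\<^sub>R \<bar>M\<bar>"
    and Qs: "norm (transpose Qs ** Qs - mat 1) \<le> 1 / 50"
    and Ed: "\<bar>R\<^sub>0 ** N - R\<^sub>1\<bar> \<le> (51 / 50 * n * u) *\<^sub>R (\<bar>R\<^sub>0\<bar> ** \<bar>N\<bar>)"
    and \<mu>: "0 < \<mu>" "\<And>v. \<mu> * norm v \<le> norm (M *v v)"
    and \<nu>: "0 < \<nu>" "\<And>v. \<nu> * norm v \<le> norm (N *v v)"
    and k: "0 \<le> k" "k < e" "norm (S ** X - Xs) = k * spectral_norm X"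
    and emb: "\<And>v. e * norm (X *v v) \<le> norm (S *v (X *v v))"
    and small_M: "51 / 2 * (s * n * u * norm M) \<le> \<mu>"
    and small_MN: "107 / 5 * (n * sqrt n * u * norm M * spectral_norm N) \<le> \<mu> * \<nu>"
    and small_k: "107 / 5 * (k * (spectral_norm M * spectral_norm N)) \<le> \<mu> * \<nu> * (e - k)"
  shows "norm R\<^sub>1 \<le> 129 / 125 * (norm M * spectral_norm N)"
    and "4507 / 5000 * (\<mu> * \<nu>) * norm v \<le> norm (R\<^sub>1 *v v)"
    and "157 / 200 * norm (R\<^sub>1 *v v) \<le> norm (S *v (X *v v))"
    and "norm (S *v (X *v v)) \<le> 243 / 200 * norm (R\<^sub>1 *v v)"
proof -
  define w where "w = \<mu> * \<nu>"
  define r where "r = sqrt n"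
  define q where "q = n * r * u * (norm M * spectral_norm N)"
  define Ma where "Ma = M - Qs ** R\<^sub>0"
  define Da where "Da = R\<^sub>0 ** N - R\<^sub>1"
  define Ba where "Ba = P ** Xs - M ** N"
  define Aa where "Aa = S ** X - Xs"
  have n1: "1 \<le> n" unfolding n_def by (simp add: Suc_leI)
  have r1: "1 \<le> r" and rr: "r * r = n" using n1 by (simp_all add: r_def)
  have "r * 1 \<le> r * r" by (intro mult_left_mono) (use r1 in auto)
  then have rn: "r \<le> n" using rr by simp
  have w: "0 < w" using \<mu> \<nu> by (simp add: w_def)
  have sM: "0 \<le> spectral_norm M" and sN: "0 \<le> spectral_norm N"
    by (rule spectral_norm_nonneg)+
  have nu: "0 \<le> 51 / 50 * n * u" using n1 u by simp
  have nN: "norm N \<le> r * spectral_norm N" and nM: "norm M \<le> r * spectral_norm M"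
    unfolding r_def n_def by (rule frob_le_spectral)+
  have qw: "107 / 5 * q \<le> w"
    using small_MN by (simp add: q_def w_def r_def mult_ac)

  have nMa: "norm Ma \<le> 51 / 50 * (s * n * u * norm M)"
    using frob_le_of_abs_le[OF Ec] u s n1 by (simp add: Ma_def mult_ac)
  \<comment> \<open>\<open>Ma\<close> is measured against \<open>\<mu>\<close> for lower bounds
    (1.02 / 25.5 is exactly 1/25) and against \<open>norm M\<close> for upper ones.\<close>
  have nMa1: "norm Ma \<le> 1 / 25 * \<mu>"
    using nMa small_M by simp
  have "s * n * u * norm M \<le> 1 / 64 * norm M" by (intro mult_right_mono snu norm_ge_zero)
  with nMa have nMa2: "norm Ma \<le> 51 / 50 / 64 * norm M" by simp

  have Qs_lower: "9899 / 10000 * norm v \<le> norm (Qs *v v)" for v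
    by (rule near_orthonormal_bounds(1)[OF Qs, where b = 2]) (simp_all add: power_divide)
  have Qs_upper: "norm (Qs *v v) \<le> 101 / 100 * norm v" for v
    by (rule near_orthonormal_bounds(2)[OF Qs, where a = 0]) (simp_all add: power_divide)

  \<comment> \<open>594/625 is 0.96 / 1.01 rounded down: \<open>Ma\<close> takes 0.04 and
    \<open>Qs\<close> stretches by at most 1.01.\<close>
  have R0_lower: "594 / 625 * \<mu> * norm v \<le> norm (R\<^sub>0 *v v)" for v
  proof -
    have "M *v v = Qs *v (R\<^sub>0 *v v) + Ma *v v"
      by (simp add: Ma_def matrix_vector_mult_diff_rdistrib matrix_vector_mul_assoc)
    then have "norm (M *v v) \<le> norm (Qs *v (R\<^sub>0 *v v)) + norm (Ma *v v)"
      by (simp add: norm_triangle_ineq)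
    moreover have "norm (Ma *v v) \<le> 1 / 25 * \<mu> * norm v"
      by (rule norm_matrix_vector_le_of_frob_le) (rule nMa1)
    ultimately have "24 / 25 * (\<mu> * norm v) \<le> 101 / 100 * norm (R\<^sub>0 *v v)"
      using \<mu>(2)[of v] Qs_upper[of "R\<^sub>0 *v v"] by simp
    moreover have "0 \<le> \<mu> * norm v" using \<mu> by simp
    ultimately show ?thesis by simp
  qed
  have nR0: "norm R\<^sub>0 \<le> 1283 / 1250 * norm M"
  proof -
    have "9899 / 10000 * norm R\<^sub>0 \<le> norm (Qs ** R\<^sub>0)"
      by (rule frob_mult_ge) (use Qs_lower in auto)
    also have "\<dots> = norm (M - Ma)" by (simp add: Ma_def)
    also have "\<dots> \<le> norm M + norm Ma" by (rule norm_triangle_ineq4)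
    finally show ?thesis using nMa2 norm_ge_zero[of M] by linarith
  qed
  have nDa: "norm Da \<le> 51 / 50 * (1283 / 1250) * q"
  proof -
    have "norm Da \<le> 51 / 50 * n * u * (norm R\<^sub>0 * norm N)"
      unfolding Da_def by (rule frob_le_of_abs_le_mult[OF Ed nu])
    also have "\<dots> \<le> 51 / 50 * n * u * ((1283 / 1250 * norm M) * (r * spectral_norm N))"
      by (intro mult_left_mono mult_mono nR0 nN nu) auto
    finally show ?thesis by (simp add: q_def mult_ac)
  qed
  then have nDa1: "norm Da \<le> 49 / 1000 * w" using qw w by simp
  have Da_vec: "norm (Da *v v) \<le> 49 / 1000 * (w * norm v)" for v
    using norm_matrix_vector_le_of_frob_le[OF nDa1, of v] by (simp only: mult.assoc)

  show "norm R\<^sub>1 \<le> 129 / 125 * (norm M * spectral_norm N)"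
  proof -
    have "n * r * u \<le> n * n * u" using rn n1 u by (intro mult_right_mono mult_left_mono) auto
    with nnu have "n * r * u \<le> 23 / 5000" by simp
    then have "q \<le> 23 / 5000 * (norm M * spectral_norm N)"
      unfolding q_def using sN by (intro mult_right_mono) auto
    moreover have "norm R\<^sub>1 \<le> norm (R\<^sub>0 ** N) + norm Da"
      using norm_triangle_ineq4[of "R\<^sub>0 ** N" Da] by (simp add: Da_def)
    moreover have "norm (R\<^sub>0 ** N) \<le> 1283 / 1250 * norm M * spectral_norm N"
      by (rule order_trans[OF frob_mult_le_spectral_right]) (intro mult_right_mono nR0 sN)
    moreover have "0 \<le> norm M * spectral_norm N" using sN by simp
    ultimately show ?thesis using nDa by simp
  qed

  have R0N: "norm (R\<^sub>0 *v (N *v v)) \<le> norm (R\<^sub>1 *v v) + 49 / 1000 * (w * norm v)"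
    "norm (R\<^sub>0 *v (N *v v)) - (49 / 1000) * (w * norm v) \<le> norm (R\<^sub>1 *v v)" for v
  proof -
    have "R\<^sub>0 *v (N *v v) = R\<^sub>1 *v v + Da *v v"
      by (simp add: Da_def matrix_vector_mult_diff_rdistrib matrix_vector_mul_assoc)
    then have "norm (R\<^sub>0 *v (N *v v)) \<le> norm (R\<^sub>1 *v v) + norm (Da *v v)"
      by (simp add: norm_triangle_ineq)
    with Da_vec[of v] show "norm (R\<^sub>0 *v (N *v v)) \<le> norm (R\<^sub>1 *v v) + 49 / 1000 * (w * norm v)"
      "norm (R\<^sub>0 *v (N *v v)) - (49 / 1000) * (w * norm v) \<le> norm (R\<^sub>1 *v v)"
      by linarith+
  qed
  \<comment> \<open>4507/5000 is 594/625 minus the 49/1000 lost to \<open>Da\<close>.\<close>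
  have R1_lower: "4507 / 5000 * (w * norm v) \<le> norm (R\<^sub>1 *v v)" for v
  proof -
    have "594 / 625 * \<mu> * (\<nu> * norm v) \<le> 594 / 625 * \<mu> * norm (N *v v)"
      using \<mu> by (intro mult_left_mono \<nu>) auto
    with R0_lower[of "N *v v"] R0N(2)[of v] show ?thesis
      by (simp add: w_def)
  qed
  then show "4507 / 5000 * (\<mu> * \<nu>) * norm v \<le> norm (R\<^sub>1 *v v)"
    by (simp only: w_def mult.assoc)

  \<comment> \<open>The first bound is later compared with \<open>w\<close>; the second, in spectral
    norms only, serves to estimate \<open>X\<close>.\<close>
  have nBa: "norm Ba \<le> 51 / 50 * q" "norm Ba \<le> 47 / 10000 * (spectral_norm M * spectral_norm N)"
  proof -
    have *: "norm Ba \<le> 51 / 50 * n * u * (norm M * norm N)"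
      unfolding Ba_def by (rule frob_le_of_abs_le_mult[OF Eb nu])
    also have "\<dots> \<le> 51 / 50 * n * u * (norm M * (r * spectral_norm N))"
      by (intro mult_left_mono nN nu) auto
    finally show "norm Ba \<le> 51 / 50 * q" by (simp add: q_def mult_ac)
    have "norm Ba \<le> 51 / 50 * n * u * ((r * spectral_norm M) * (r * spectral_norm N))"
      using r1 sM by (intro order_trans[OF *] mult_left_mono mult_mono nM nN nu) auto
    also have "\<dots> = 51 / 50 * (n * n * u) * (spectral_norm M * spectral_norm N)"
      by (simp flip: rr)
    also have "\<dots> \<le> 51 / 50 * (23 / 5000) * (spectral_norm M * spectral_norm N)"
      using sM sN by (intro mult_right_mono mult_left_mono nnu) auto
    also have "\<dots> \<le> 47 / 10000 * (spectral_norm M * spectral_norm N)"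
      using sM sN by (intro mult_right_mono) auto
    finally show "norm Ba \<le> 47 / 10000 * (spectral_norm M * spectral_norm N)" .
  qed
  have nBa1: "norm Ba \<le> 477 / 10000 * w" using nBa(1) qw w by simp

  have PSX: "P *v (S *v (X *v v)) = M *v (N *v v) + Ba *v v + P *v (Aa *v v)" for v
    by (simp add: Ba_def Aa_def matrix_vector_mult_diff_rdistrib matrix_vector_mult_diff_distrib
        matrix_vector_mul_assoc matrix_mul_assoc)
  have PSX_norm: "norm (S *v (X *v v)) = norm (P *v (S *v (X *v v)))" for v
    by (simp add: norm_permutation_matrix[OF P])
  have Aa_vec: "norm (P *v (Aa *v v)) \<le> k * spectral_norm X * norm v" for v
    unfolding norm_permutation_matrix[OF P]
    using norm_matrix_vector_le_frob[of Aa v] k(3) by (simp add: Aa_def)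

  have e: "0 < e" using k by simp
  \<comment> \<open>The norm of \<open>X\<close> is recovered from its sketch, which is
    \<open>M ** N\<close> up to errors. The sketching error brings
    \<open>k * spectral_norm X\<close> back on the right; moved to the left it leaves the factor
    \<open>e - k\<close>.\<close>
  have ex: "e * spectral_norm X \<le> 10047 / 10000 * (spectral_norm M * spectral_norm N) + k * spectral_norm X"
  proof -
    have "norm (X *v v) \<le> (10047 / 10000 * (spectral_norm M * spectral_norm N) + k * spectral_norm X) / e * norm v" for v
    proof -
      have "norm (M *v (N *v v)) \<le> spectral_norm M * (spectral_norm N * norm v)"
        by (rule order_trans[OF norm_matrix_vector_le_spectral])
           (intro mult_left_mono norm_matrix_vector_le_spectral sM)
      moreover have "norm (Ba *v v) \<le> 47 / 10000 * (spectral_norm M * spectral_norm N) * norm v"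
        by (rule norm_matrix_vector_le_of_frob_le) (rule nBa(2))
      moreover have "e * norm (X *v v) \<le> norm (M *v (N *v v)) + norm (Ba *v v) + norm (P *v (Aa *v v))"
        using emb[of v] unfolding PSX_norm PSX by (meson norm_triangle_ineq order_trans add_mono order_refl)
      ultimately have "e * norm (X *v v) \<le> (10047 / 10000 * (spectral_norm M * spectral_norm N) + k * spectral_norm X) * norm v"
        using Aa_vec[of v] by (simp add: algebra_simps)
      then show ?thesis using e by (simp add: field_simps)
    qed
    then have "spectral_norm X \<le> (10047 / 10000 * (spectral_norm M * spectral_norm N) + k * spectral_norm X) / e"
      by (rule spectral_norm_le)
    then show ?thesis using e by (simp add: field_simps)
  qed
  \<comment> \<open>Multiplying by the positive \<open>e - k\<close> makes \<open>ex\<close> and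
    then \<open>small_k\<close> applicable, after which the factor cancels; 1.0047 / 21.4 is below
    0.047.\<close>
  have kx: "k * spectral_norm X \<le> 47 / 1000 * w"
  proof -
    have "k * ((e - k) * spectral_norm X) \<le> k * (10047 / 10000 * (spectral_norm M * spectral_norm N))"
      using ex by (intro mult_left_mono k) (simp add: algebra_simps)
    also have "\<dots> = 10047 / 10000 / (107 / 5) * (107 / 5 * (k * (spectral_norm M * spectral_norm N)))"
      by simp
    also have "\<dots> \<le> 10047 / 10000 / (107 / 5) * (w * (e - k))"
      unfolding w_def by (intro mult_left_mono small_k) simp
    also have "\<dots> \<le> 47 / 1000 * (w * (e - k))"
      using w k by (intro mult_right_mono) auto
    finally have "(k * spectral_norm X) * (e - k) \<le> (47 / 1000 * w) * (e - k)" by (simp add: mult_ac)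
    then show ?thesis using k by simp
  qed

  \<comment> \<open>In the term with \<open>Ma\<close>, \<open>\<mu> * norm (N *v v)\<close> is led
    back to \<open>R\<^sub>1 *v v\<close> through \<open>R\<^sub>0\<close>, without the norm of
    \<open>N\<close>. The remaining contributions are multiples of \<open>w * norm v\<close>, which
    \<open>R1_lower\<close> converts; together they stay below 0.2044.\<close>
  have diff: "norm (P *v (S *v (X *v v)) - Qs *v (R\<^sub>1 *v v)) \<le> 511 / 2500 * norm (R\<^sub>1 *v v)" for v
  proof -
    have "P *v (S *v (X *v v)) - Qs *v (R\<^sub>1 *v v)
        = Qs *v (Da *v v) + Ma *v (N *v v) + Ba *v v + P *v (Aa *v v)"
      unfolding PSX
      by (simp add: Da_def Ma_def matrix_vector_mult_diff_rdistrib matrix_vector_mult_diff_distrib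
          flip: matrix_vector_mul_assoc)
    then have "norm (P *v (S *v (X *v v)) - Qs *v (R\<^sub>1 *v v))
        \<le> norm (Qs *v (Da *v v)) + norm (Ma *v (N *v v)) + norm (Ba *v v) + norm (P *v (Aa *v v))"
      by (simp only:) (meson norm_triangle_ineq order_trans add_mono order_refl)
    moreover have "norm (Qs *v (Da *v v)) \<le> 101 / 100 * (49 / 1000 * (w * norm v))"
      using Qs_upper[of "Da *v v"] Da_vec[of v] by simp
    moreover have "norm (Ba *v v) \<le> 477 / 10000 * (w * norm v)"
      using norm_matrix_vector_le_of_frob_le[OF nBa1, of v] by (simp only: mult.assoc)
    moreover have "norm (P *v (Aa *v v)) \<le> 47 / 1000 * (w * norm v)"
      using order_trans[OF Aa_vec mult_right_mono[OF kx norm_ge_zero]] by (simp only: mult.assoc)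
    moreover have "norm (Ma *v (N *v v)) \<le> 1 / 25 * (\<mu> * norm (N *v v))"
      using norm_matrix_vector_le_of_frob_le[OF nMa1] by (simp only: mult.assoc)
    moreover have "594 / 625 * (\<mu> * norm (N *v v)) \<le> norm (R\<^sub>1 *v v) + 49 / 1000 * (w * norm v)"
      using R0_lower[of "N *v v"] R0N(1)[of v] by simp
    ultimately show ?thesis using R1_lower[of v] norm_ge_zero[of "R\<^sub>1 *v v"] by linarith
  qed
  show "157 / 200 * norm (R\<^sub>1 *v v) \<le> norm (S *v (X *v v))"
    using diff[of v] Qs_lower[of "R\<^sub>1 *v v"] norm_triangle_ineq3[of "P *v (S *v (X *v v))" "Qs *v (R\<^sub>1 *v v)"]
    unfolding PSX_norm by (simp add: abs_le_iff)
  show "norm (S *v (X *v v)) \<le> 243 / 200 * norm (R\<^sub>1 *v v)"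
    using diff[of v] Qs_upper[of "R\<^sub>1 *v v"] norm_triangle_ineq3[of "P *v (S *v (X *v v))" "Qs *v (R\<^sub>1 *v v)"]
    unfolding PSX_norm by (simp add: abs_le_iff)
qed

text \<open>With \<open>C\<close> inverse to \<open>R\<^sub>1\<close>, \<open>Q\<^sub>1\<close> is
  \<open>X ** C + E ** C\<close>. By \<open>pre\<close>, \<open>S ** X ** C\<close> stretches
  vectors by factors between 0.785 and 1.215, and the distortions \<open>e\<close> and
  \<open>f\<close> of the sketch carry this over to \<open>X ** C\<close>. In the application
  \<open>\<omega>\<close> is the product of the smallest singular values of the LU factors and
  \<open>c\<close> bounds the product of their norms.\<close>

lemma preconditioned_factor_bounds:
  fixes X Q\<^sub>1 :: "real^'n^'m" and S :: "real^'m^'s" and R\<^sub>1 :: "real^'n^'n"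
    and u e f \<omega> c n :: real
  assumes n_def: "n = real CARD('n)"
    and u: "0 \<le> u" and e: "0 < e" and f: "0 < f" and \<omega>: "0 < \<omega>" and c: "0 \<le> c"
    and Ee: "\<bar>Q\<^sub>1 ** R\<^sub>1 - X\<bar> \<le> (51 / 50 * n * u) *\<^sub>R (\<bar>Q\<^sub>1\<bar> ** \<bar>R\<^sub>1\<bar>)"
    and R1: "norm R\<^sub>1 \<le> 129 / 125 * c" "\<And>v. 4507 / 5000 * \<omega> * norm v \<le> norm (R\<^sub>1 *v v)"
    and small: "107 / 5 * (n * sqrt n * u * c) \<le> \<omega>"
    and emb: "\<And>v. e * norm (X *v v) \<le> norm (S *v (X *v v))"
      "\<And>v. norm (S *v (X *v v)) \<le> f * norm (X *v v)"
    and pre: "\<And>v. (157 / 200) * norm (R\<^sub>1 *v v) \<le> norm (S *v (X *v v))"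
      "\<And>v. norm (S *v (X *v v)) \<le> 243 / 200 * norm (R\<^sub>1 *v v)"
  shows "norm (Q\<^sub>1 *v w) \<le> 643 / 500 / e * norm w"
    and "(157 / 200 / f - 703 / 10000 / e) * norm w \<le> norm (Q\<^sub>1 *v w)"
proof -
  define b where "b = spectral_norm Q\<^sub>1"
  define E where "E = Q\<^sub>1 ** R\<^sub>1 - X"
  have b0: "0 \<le> b" unfolding b_def by (rule spectral_norm_nonneg)
  have n0: "0 \<le> n" by (simp add: n_def)
  obtain C where C: "R\<^sub>1 ** C = mat 1"
    using inverse_of_lower_bound[of "4507 / 5000 * \<omega>" R\<^sub>1] \<omega> R1(2) by auto
  have nE: "norm E \<le> 123 / 2500 * (\<omega> * b)"
  proof -
    have nu: "0 \<le> 51 / 50 * n * u" using u n0 by simp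
    have "norm E \<le> 51 / 50 * n * u * (norm Q\<^sub>1 * norm R\<^sub>1)"
      unfolding E_def by (rule frob_le_of_abs_le_mult[OF Ee nu])
    also have "\<dots> \<le> 51 / 50 * n * u * ((sqrt n * b) * (129 / 125 * c))"
      unfolding b_def n_def
      by (intro mult_left_mono mult_mono frob_le_spectral R1 nu[unfolded n_def])
         (auto simp: spectral_norm_nonneg)
    also have "\<dots> = 51 / 50 * (129 / 125) * (n * sqrt n * u * c) * b" by (simp add: mult_ac)
    also have "\<dots> \<le> 51 / 50 * (129 / 125) * (\<omega> / (107 / 5)) * b"
      using small by (intro mult_right_mono mult_left_mono b0) auto
    also have "\<dots> \<le> 123 / 2500 * \<omega> * b" using \<omega> by (intro mult_right_mono b0) auto
    finally show ?thesis by simp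
  qed
  have E_vec: "norm (E *v v) \<le> 273 / 5000 * b * norm (R\<^sub>1 *v v)" for v
  proof -
    have "norm (E *v v) \<le> 123 / 2500 * (\<omega> * b) * norm v"
      by (rule norm_matrix_vector_le_of_frob_le) (rule nE)
    also have "\<dots> = 123 / 2500 / (4507 / 5000) * b * (4507 / 5000 * \<omega> * norm v)" by simp
    also have "\<dots> \<le> 123 / 2500 / (4507 / 5000) * b * norm (R\<^sub>1 *v v)"
      using b0 by (intro mult_left_mono R1) auto
    also have "\<dots> \<le> 273 / 5000 * b * norm (R\<^sub>1 *v v)"
      using b0 by (intro mult_right_mono) auto
    finally show ?thesis .
  qed
  have R1C: "R\<^sub>1 *v (C *v w) = w" for w by (simp add: matrix_vector_mul_assoc C)
  have Q1: "Q\<^sub>1 *v w = X *v (C *v w) + E *v (C *v w)" for w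
    by (simp add: E_def matrix_vector_mult_diff_rdistrib R1C flip: matrix_vector_mul_assoc)
  have X_upper: "norm (X *v (C *v w)) \<le> 243 / 200 / e * norm w"
    and X_lower: "157 / 200 / f * norm w \<le> norm (X *v (C *v w))" for w
    using order_trans[OF emb(1) pre(2), of "C *v w"] order_trans[OF pre(1) emb(2), of "C *v w"] e f
    by (simp_all add: R1C field_simps)
  \<comment> \<open>The residual of the solve is relative to \<open>Q\<^sub>1\<close>, so
    \<open>b\<close> stands on both sides; solving for it uses 1.215 / (1 - 0.0546) < 1.286.\<close>
  have "b \<le> 243 / 200 / e + 273 / 5000 * b"
    unfolding b_def
  proof (rule spectral_norm_le)
    fix w
    have "norm (Q\<^sub>1 *v w) \<le> norm (X *v (C *v w)) + norm (E *v (C *v w))"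
      unfolding Q1 by (rule norm_triangle_ineq)
    also have "\<dots> \<le> 243 / 200 / e * norm w + 273 / 5000 * b * norm w"
      using X_upper[of w] E_vec[of "C *v w"] by (simp add: R1C)
    finally show "norm (Q\<^sub>1 *v w) \<le> (243 / 200 / e + 273 / 5000 * spectral_norm Q\<^sub>1) * norm w"
      by (simp add: b_def distrib_right)
  qed
  then have b: "b \<le> 643 / 500 / e" using e by (simp add: field_simps)
  show "norm (Q\<^sub>1 *v w) \<le> 643 / 500 / e * norm w"
    using b norm_matrix_vector_le_spectral[of Q\<^sub>1 w] unfolding b_def
    by (meson mult_right_mono norm_ge_zero order_trans)
  have "273 / 5000 * b * norm w \<le> 273 / 5000 * (643 / 500 / e) * norm w"
    by (intro mult_right_mono mult_left_mono b) auto
  also have "\<dots> \<le> 703 / 10000 / e * norm w"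
    using e by (intro mult_right_mono) (auto simp: field_simps)
  finally have "norm (E *v (C *v w)) \<le> 703 / 10000 / e * norm w"
    using E_vec[of "C *v w"] by (simp add: R1C)
  then have "157 / 200 / f * norm w - (703 / 10000) / e * norm w \<le> norm (Q\<^sub>1 *v w)"
    using X_lower[of w] norm_triangle_ineq4[of "X *v (C *v w) + E *v (C *v w)" "E *v (C *v w)"]
    unfolding Q1 by simp
  then show "(157 / 200 / f - 703 / 10000 / e) * norm w \<le> norm (Q\<^sub>1 *v w)"
    by (simp add: left_diff_distrib)
qed

section \<open>CholeskyQR2\<close>

text \<open>The first step leaves a defect of at most 3.21/64, so the singular values of
  \<open>Q\<^sub>2\<close> lie in [0.974, 1.025], and the second step runs with these constants. The
  norm bounds are for the residual estimate.\<close>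

lemma cholesky_qr2_orthogonality:
  fixes Q\<^sub>1 Q\<^sub>2 Q :: "real^'n^'m" and R\<^sub>2 R\<^sub>4 G G\<^sub>1 :: "real^'n^'n" and a b m n u T :: real
  assumes m_def: "m = real CARD('m)" and n_def: "n = real CARD('n)"
    and u: "0 \<le> u" and T: "T = m * n * u + n * (n + 1) * u" "T \<le> 23 / 5000" "T * b\<^sup>2 \<le> a\<^sup>2 / 64"
    and a: "0 < a" and lower: "\<And>v. a * norm v \<le> norm (Q\<^sub>1 *v v)"
    and upper: "\<And>v. norm (Q\<^sub>1 *v v) \<le> b * norm v"
    and E1: "\<bar>G - transpose Q\<^sub>1 ** Q\<^sub>1\<bar> \<le> (51 / 50 * m * u) *\<^sub>R (\<bar>transpose Q\<^sub>1\<bar> ** \<bar>Q\<^sub>1\<bar>)"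
    and E2: "\<bar>transpose R\<^sub>2 ** R\<^sub>2 - G\<bar> \<le> (51 / 50 * (n + 1) * u) *\<^sub>R (\<bar>transpose R\<^sub>2\<bar> ** \<bar>R\<^sub>2\<bar>)"
    and E3: "\<bar>Q\<^sub>2 ** R\<^sub>2 - Q\<^sub>1\<bar> \<le> (51 / 50 * n * u) *\<^sub>R (\<bar>Q\<^sub>2\<bar> ** \<bar>R\<^sub>2\<bar>)"
    and E5: "\<bar>G\<^sub>1 - transpose Q\<^sub>2 ** Q\<^sub>2\<bar> \<le> (51 / 50 * m * u) *\<^sub>R (\<bar>transpose Q\<^sub>2\<bar> ** \<bar>Q\<^sub>2\<bar>)"
    and E6: "\<bar>transpose R\<^sub>4 ** R\<^sub>4 - G\<^sub>1\<bar> \<le> (51 / 50 * (n + 1) * u) *\<^sub>R (\<bar>transpose R\<^sub>4\<bar> ** \<bar>R\<^sub>4\<bar>)"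
    and E7: "\<bar>Q ** R\<^sub>4 - Q\<^sub>2\<bar> \<le> (51 / 50 * n * u) *\<^sub>R (\<bar>Q\<bar> ** \<bar>R\<^sub>4\<bar>)"
  shows "norm R\<^sub>2 \<le> 201 / 200 * (sqrt n * b)" and "norm (R\<^sub>2 *v v) \<le> 201 / 200 * b * norm v"
    and "norm (Q\<^sub>2 *v v) \<le> 41 / 40 * norm v" and "norm R\<^sub>4 \<le> 5151 / 5000 * sqrt n"
    and "norm (R\<^sub>4 *v v) \<le> 5151 / 5000 * norm v" and "norm (Q *v v) \<le> 101 / 100 * norm v"
    and "norm (transpose Q ** Q - mat 1) \<le> 6 * T"
proof -
  note first = cholesky_qr_step[OF m_def n_def u T(1,2,3) a lower upper E1 E2 E3]
  show "norm R\<^sub>2 \<le> 201 / 200 * (sqrt n * b)" "norm (R\<^sub>2 *v v) \<le> 201 / 200 * b * norm v"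
    by (rule first(2), rule first(3))
  have "T * (b / a)\<^sup>2 \<le> 1 / 64" using T(3) a by (simp add: power_divide field_simps)
  with first(1) have orth2: "norm (transpose Q\<^sub>2 ** Q\<^sub>2 - mat 1) \<le> 321 / 100 / 64" by linarith
  have lower2: "487 / 500 * norm v \<le> norm (Q\<^sub>2 *v v)" for v
    by (rule near_orthonormal_bounds(1)[OF orth2, where b = 2]) (simp_all add: power_divide)
  have upper2: "norm (Q\<^sub>2 *v v) \<le> 41 / 40 * norm v" for v
    by (rule near_orthonormal_bounds(2)[OF orth2, where a = 0]) (simp_all add: power_divide)
  then show "norm (Q\<^sub>2 *v v) \<le> 41 / 40 * norm v" .
  have T0: "0 \<le> T" using u unfolding T(1) m_def n_def by simp
  \<comment> \<open>For the nearly orthonormal \<open>Q\<^sub>2\<close> this smallness condition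
    follows from the bound on \<open>T\<close> alone.\<close>
  have T3: "T * (41 / 40)\<^sup>2 \<le> (487 / 500)\<^sup>2 / 64" using T(2) by (simp add: power_divide)
  have pos2: "(0::real) < 487 / 500" by simp
  note second = cholesky_qr_step[OF m_def n_def u T(1,2) T3 pos2 lower2 upper2 E5 E6 E7]
  show "norm R\<^sub>4 \<le> 5151 / 5000 * sqrt n" 
    by (rule order_trans[OF second(2)]) (simp add: n_def)
  show "norm (R\<^sub>4 *v v) \<le> 5151 / 5000 * norm v" 
    by (rule order_trans[OF second(3)]) (simp add: mult_right_mono)
  \<comment> \<open>3.56 is 3.21 * (1.025 / 0.974)^2 rounded up.\<close>
  have orth: "norm (transpose Q ** Q - mat 1) \<le> 89 / 25 * T"
    using second(1) T0 by (simp add: power_divide)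
  with T0 show "norm (transpose Q ** Q - mat 1) \<le> 6 * T" by simp
  have "norm (transpose Q ** Q - mat 1) \<le> 201 / 10000" using orth T(2) by simp
  then show "norm (Q *v v) \<le> 101 / 100 * norm v"
    by (rule near_orthonormal_bounds(2)[where a = 0]) (simp_all add: power_divide)
qed

text \<open>In the telescoped residual, \<open>F\<^sub>3 ** R\<^sub>1\<close> and
  \<open>F\<^sub>7 ** R\<^sub>3\<close> are charged to the spectral norm of \<open>R\<^sub>1\<close>
  with factor \<open>n\<^sup>2 * u\<close>, the other three terms to its Frobenius norm with the
  smaller factor \<open>n * sqrt n * u\<close>. The factor \<open>b\<close> comes from
  \<open>Q\<^sub>1\<close> and \<open>R\<^sub>2\<close>, the 1/a from bounding
  \<open>R\<^sub>1\<close> by \<open>X\<close>.\<close>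

lemma cholesky_qr2_residual:
  fixes X Q\<^sub>1 Q\<^sub>2 Q :: "real^'n^'m" and R\<^sub>1 R\<^sub>2 R\<^sub>3 R\<^sub>4 R :: "real^'n^'n" and a b n u T :: real
  assumes n_def: "n = real CARD('n)"
    and u: "0 \<le> u" and nnu: "n * n * u \<le> 23 / 5000" and nnub: "n * n * u * b \<le> a / 64"
    and a: "0 < a" and lower: "\<And>v. a * norm v \<le> norm (Q\<^sub>1 *v v)"
    and upper: "\<And>v. norm (Q\<^sub>1 *v v) \<le> b * norm v"
    and Ee: "\<bar>Q\<^sub>1 ** R\<^sub>1 - X\<bar> \<le> (51 / 50 * n * u) *\<^sub>R (\<bar>Q\<^sub>1\<bar> ** \<bar>R\<^sub>1\<bar>)"
    and E3: "\<bar>Q\<^sub>2 ** R\<^sub>2 - Q\<^sub>1\<bar> \<le> (51 / 50 * n * u) *\<^sub>R (\<bar>Q\<^sub>2\<bar> ** \<bar>R\<^sub>2\<bar>)"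
    and E4: "\<bar>R\<^sub>3 - R\<^sub>2 ** R\<^sub>1\<bar> \<le> (51 / 50 * n * u) *\<^sub>R (\<bar>R\<^sub>2\<bar> ** \<bar>R\<^sub>1\<bar>)"
    and E7: "\<bar>Q ** R\<^sub>4 - Q\<^sub>2\<bar> \<le> (51 / 50 * n * u) *\<^sub>R (\<bar>Q\<bar> ** \<bar>R\<^sub>4\<bar>)"
    and E8: "\<bar>R - R\<^sub>4 ** R\<^sub>3\<bar> \<le> (51 / 50 * n * u) *\<^sub>R (\<bar>R\<^sub>4\<bar> ** \<bar>R\<^sub>3\<bar>)"
    and R2: "norm R\<^sub>2 \<le> 201 / 200 * (sqrt n * b)" "\<And>v. norm (R\<^sub>2 *v v) \<le> 201 / 200 * b * norm v"
    and Q2: "\<And>v. norm (Q\<^sub>2 *v v) \<le> 41 / 40 * norm v"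
    and R4: "norm R\<^sub>4 \<le> 5151 / 5000 * sqrt n"
    and Q: "\<And>v. norm (Q *v v) \<le> 101 / 100 * norm v"
  shows "norm (Q ** R - X) \<le> 321 / 100 * (b / a) * (n * sqrt n * u) * norm X
      + 109 / 50 * (b / a) * (n\<^sup>2 * u) * spectral_norm X"
proof -
  define r where "r = sqrt n"
  define f where "f = norm R\<^sub>1"
  define g where "g = spectral_norm R\<^sub>1"
  define F\<^sub>0 where "F\<^sub>0 = Q\<^sub>1 ** R\<^sub>1 - X"
  define F\<^sub>3 where "F\<^sub>3 = Q\<^sub>2 ** R\<^sub>2 - Q\<^sub>1"
  define F\<^sub>4 where "F\<^sub>4 = R\<^sub>3 - R\<^sub>2 ** R\<^sub>1"
  define F\<^sub>7 where "F\<^sub>7 = Q ** R\<^sub>4 - Q\<^sub>2"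
  define F\<^sub>8 where "F\<^sub>8 = R - R\<^sub>4 ** R\<^sub>3"
  have n1: "1 \<le> n" unfolding n_def by (simp add: Suc_leI)
  have r1: "1 \<le> r" and rr: "r * r = n" using n1 by (simp_all add: r_def)
  have "r * 1 \<le> r * r" by (intro mult_left_mono) (use r1 in auto)
  then have rn: "r \<le> n" using rr by simp
  have nu0: "0 \<le> 51 / 50 * n * u" using n1 u by simp
  have "a * norm (axis undefined 1 :: real^'n) \<le> b * norm (axis undefined 1 :: real^'n)"
    using lower upper by (rule order_trans)
  then have "a \<le> b" by simp
  with a have b: "0 < b" by simp
  have f0: "0 \<le> f" and g0: "0 \<le> g" by (simp_all add: f_def g_def spectral_norm_nonneg)
  have fg: "f \<le> r * g" unfolding f_def g_def r_def n_def by (rule frob_le_spectral)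
  have nru: "n * r * u \<le> n * n * u" using rn n1 u by (intro mult_right_mono mult_left_mono) auto
  have nQ1: "norm Q\<^sub>1 \<le> r * b" unfolding r_def n_def using upper by (rule frob_le_of_bound)
  have nQ2: "norm Q\<^sub>2 \<le> r * (41 / 40)" unfolding r_def n_def using Q2 by (rule frob_le_of_bound)
  have nQ: "norm Q \<le> r * (101 / 100)" unfolding r_def n_def using Q by (rule frob_le_of_bound)
  have sQ2: "spectral_norm Q\<^sub>2 \<le> 41 / 40" using Q2 by (rule spectral_norm_le)
  have sQ: "spectral_norm Q \<le> 101 / 100" using Q by (rule spectral_norm_le)
  have sR2: "spectral_norm R\<^sub>2 \<le> 201 / 200 * b" using R2(2) by (rule spectral_norm_le)
  have nR2: "norm R\<^sub>2 \<le> 201 / 200 * (r * b)" using R2(1) by (simp add: r_def)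
  have nR4: "norm R\<^sub>4 \<le> 5151 / 5000 * r" using R4 by (simp add: r_def)

  have F0: "norm F\<^sub>0 \<le> 51 / 50 * (n * r * u * b * f)"
  proof -
    have "norm F\<^sub>0 \<le> 51 / 50 * n * u * (norm Q\<^sub>1 * norm R\<^sub>1)"
      unfolding F\<^sub>0_def by (rule frob_le_of_abs_le_mult[OF Ee nu0])
    also have "\<dots> \<le> 51 / 50 * n * u * (r * b * f)"
      unfolding f_def by (intro mult_left_mono mult_right_mono nQ1 nu0 norm_ge_zero)
    finally show ?thesis by (simp add: mult_ac)
  qed
  have nnub': "n * n * u * b * t \<le> a / 64 * t" if "0 \<le> t" for t
    using nnub that by (rule mult_right_mono)
  \<comment> \<open>\<open>F\<^sub>0\<close> contains \<open>f\<close> itself, but by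
    \<open>nnub\<close> its share is at most 1.02/64 of \<open>a * f\<close> and can be absorbed; 1
    / (1 - 1.02/64) < 1.0163.\<close>
  have f: "a * f \<le> 10163 / 10000 * norm X"
  proof -
    have "a * f \<le> norm (Q\<^sub>1 ** R\<^sub>1)" unfolding f_def using a lower by (intro frob_mult_ge) auto
    also have "Q\<^sub>1 ** R\<^sub>1 = X + F\<^sub>0" by (simp add: F\<^sub>0_def)
    also have "norm \<dots> \<le> norm X + norm F\<^sub>0" by (rule norm_triangle_ineq)
    finally have "a * f \<le> norm X + 51 / 50 * (n * r * u * b * f)" using F0 by simp
    moreover have "n * r * u * b * f \<le> n * n * u * b * f"
      using b f0 by (intro mult_right_mono nru) auto
    ultimately show ?thesis using nnub'[OF f0] norm_ge_zero[of X] by linarith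
  qed
  \<comment> \<open>The same absorption in the spectral norm. Replacing \<open>f\<close> by
    \<open>r * g\<close> raises the factor to \<open>n * n * u\<close>, which \<open>nnub\<close>
    covers.\<close>
  have g: "a * g \<le> 10163 / 10000 * spectral_norm X"
  proof -
    have "norm (R\<^sub>1 *v v) \<le> (spectral_norm X + 51 / 50 * (n * n * u * b * g)) / a * norm v" for v
    proof -
      have "n * r * u * b * f \<le> n * r * u * b * (r * g)"
        using n1 r1 u b by (intro mult_left_mono fg) auto
      also have "\<dots> = n * n * u * b * g" by (simp flip: rr)
      finally have "norm F\<^sub>0 \<le> 51 / 50 * (n * n * u * b * g)" using F0 by simp
      then have "norm (F\<^sub>0 *v v) \<le> 51 / 50 * (n * n * u * b * g) * norm v"
        by (rule norm_matrix_vector_le_of_frob_le)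
      moreover have "Q\<^sub>1 *v (R\<^sub>1 *v v) = X *v v + F\<^sub>0 *v v"
        by (simp add: F\<^sub>0_def matrix_vector_mult_diff_rdistrib matrix_vector_mul_assoc)
      then have "a * norm (R\<^sub>1 *v v) \<le> norm (X *v v) + norm (F\<^sub>0 *v v)"
        using lower[of "R\<^sub>1 *v v"] norm_triangle_ineq[of "X *v v" "F\<^sub>0 *v v"] by simp
      ultimately have "a * norm (R\<^sub>1 *v v) \<le> (spectral_norm X + 51 / 50 * (n * n * u * b * g)) * norm v"
        using norm_matrix_vector_le_spectral[of X v] by (simp only: distrib_right)
      then show ?thesis using a by (simp add: field_simps)
    qed
    then have "g \<le> (spectral_norm X + 51 / 50 * (n * n * u * b * g)) / a"
      unfolding g_def by (rule spectral_norm_le)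
    then have "a * g \<le> spectral_norm X + 51 / 50 * (n * n * u * b * g)"
      using a by (simp add: field_simps)
    then show ?thesis using nnub'[OF g0] spectral_norm_nonneg[of X] by linarith
  qed

  have F4: "norm F\<^sub>4 \<le> 51 / 50 * (201 / 200) * (n * r * u * b * f)"
  proof -
    have "norm F\<^sub>4 \<le> 51 / 50 * n * u * (norm R\<^sub>2 * norm R\<^sub>1)"
      unfolding F\<^sub>4_def by (rule frob_le_of_abs_le_mult[OF E4 nu0])
    also have "\<dots> \<le> 51 / 50 * n * u * (201 / 200 * (r * b) * f)"
      unfolding f_def by (intro mult_left_mono mult_right_mono nR2 nu0 norm_ge_zero)
    finally show ?thesis by (simp add: mult_ac)
  qed
  have R3_eq: "R\<^sub>3 = R\<^sub>2 ** R\<^sub>1 + F\<^sub>4" by (simp add: F\<^sub>4_def)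
  have nR3: "norm R\<^sub>3 \<le> 5049 / 5000 * (b * f)"
  proof -
    have "norm (R\<^sub>2 ** R\<^sub>1) \<le> 201 / 200 * b * f"
      unfolding f_def
      by (rule order_trans[OF frob_mult_le_spectral_left]) (intro mult_right_mono sR2 norm_ge_zero)
    moreover have "n * r * u * (b * f) \<le> 23 / 5000 * (b * f)"
      using nru nnu b f0 by (intro mult_right_mono) auto
    moreover have "norm R\<^sub>3 \<le> norm (R\<^sub>2 ** R\<^sub>1) + norm F\<^sub>4"
      unfolding R3_eq by (rule norm_triangle_ineq)
    moreover have "0 \<le> b * f" using b f0 by simp
    ultimately show ?thesis using F4 by simp
  qed
  have sR3: "spectral_norm R\<^sub>3 \<le> 5049 / 5000 * (b * g)"
  proof (rule spectral_norm_le)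
    fix v
    have "R\<^sub>3 *v v = R\<^sub>2 *v (R\<^sub>1 *v v) + F\<^sub>4 *v v"
      by (simp add: F\<^sub>4_def matrix_vector_mult_diff_rdistrib matrix_vector_mul_assoc)
    then have "norm (R\<^sub>3 *v v) \<le> norm (R\<^sub>2 *v (R\<^sub>1 *v v)) + norm (F\<^sub>4 *v v)"
      by (simp add: norm_triangle_ineq)
    moreover have "norm (R\<^sub>2 *v (R\<^sub>1 *v v)) \<le> 201 / 200 * b * (g * norm v)"
      unfolding g_def using b
      by (intro order_trans[OF R2(2)] mult_left_mono norm_matrix_vector_le_spectral) auto
    moreover have "norm (F\<^sub>4 *v v) \<le> 51 / 50 * (201 / 200) * (23 / 5000) * (b * g) * norm v"
    proof (rule norm_matrix_vector_le_of_frob_le)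
      have "n * r * u * b * f \<le> n * r * u * b * (r * g)"
        using n1 r1 u b by (intro mult_left_mono fg) auto
      also have "\<dots> = n * n * u * (b * g)" by (simp flip: rr)
      also have "\<dots> \<le> 23 / 5000 * (b * g)" using b g0 by (intro mult_right_mono nnu) auto
      finally show "norm F\<^sub>4 \<le> 51 / 50 * (201 / 200) * (23 / 5000) * (b * g)" using F4 by simp
    qed
    moreover have "0 \<le> b * g * norm v" using b g0 by simp
    ultimately show "norm (R\<^sub>3 *v v) \<le> 5049 / 5000 * (b * g) * norm v" by (simp add: mult_ac)
  qed

  have "Q ** R - X = F\<^sub>0 + F\<^sub>3 ** R\<^sub>1 + Q\<^sub>2 ** F\<^sub>4 + F\<^sub>7 ** R\<^sub>3 + Q ** F\<^sub>8"
    by (simp add: F\<^sub>0_def F\<^sub>3_def F\<^sub>4_def F\<^sub>7_def F\<^sub>8_def matrix_mult_diff_left matrix_mult_diff_right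
        matrix_mul_assoc)
  then have "norm (Q ** R - X) \<le> norm F\<^sub>0 + norm (F\<^sub>3 ** R\<^sub>1) + norm (Q\<^sub>2 ** F\<^sub>4)
      + norm (F\<^sub>7 ** R\<^sub>3) + norm (Q ** F\<^sub>8)"
    by (simp only:) (meson norm_triangle_ineq order_trans add_mono order_refl)
  moreover have "norm (F\<^sub>3 ** R\<^sub>1) \<le> 51 / 50 * (41 / 40) * (201 / 200) * (n * n * u * (b * g))"
  proof -
    have "norm (F\<^sub>3 ** R\<^sub>1) \<le> norm F\<^sub>3 * g"
      unfolding g_def by (rule frob_mult_le_spectral_right)
    also have "\<dots> \<le> 51 / 50 * n * u * (norm Q\<^sub>2 * norm R\<^sub>2) * g"
      unfolding F\<^sub>3_def by (intro mult_right_mono frob_le_of_abs_le_mult[OF E3 nu0] g0)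
    also have "\<dots> \<le> 51 / 50 * n * u * ((r * (41 / 40)) * (201 / 200 * (r * b))) * g"
      using r1 by (intro mult_right_mono mult_left_mono mult_mono nQ2 nR2 nu0 g0) auto
    finally show ?thesis by (simp add: mult_ac flip: rr)
  qed
  moreover have "norm (Q\<^sub>2 ** F\<^sub>4) \<le> 41 / 40 * (51 / 50 * (201 / 200) * (n * r * u * b * f))"
    by (intro order_trans[OF frob_mult_le_spectral_left] mult_mono sQ2 F4) auto
  moreover have "norm (F\<^sub>7 ** R\<^sub>3) \<le> 51 / 50 * (101 / 100) * (5151 / 5000) * (5049 / 5000) * (n * n * u * (b * g))"
  proof -
    have "norm (F\<^sub>7 ** R\<^sub>3) \<le> norm F\<^sub>7 * spectral_norm R\<^sub>3"
      by (rule frob_mult_le_spectral_right)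
    also have "\<dots> \<le> 51 / 50 * n * u * (norm Q * norm R\<^sub>4) * spectral_norm R\<^sub>3"
      unfolding F\<^sub>7_def
      by (intro mult_right_mono frob_le_of_abs_le_mult[OF E7 nu0] spectral_norm_nonneg)
    also have "\<dots> \<le> 51 / 50 * n * u * ((r * (101 / 100)) * (5151 / 5000 * r)) * (5049 / 5000 * (b * g))"
      using r1 nu0 by (intro mult_mono mult_left_mono nQ nR4 nu0 sR3 mult_nonneg_nonneg
          spectral_norm_nonneg) auto
    finally show ?thesis by (simp add: mult_ac flip: rr)
  qed
  moreover have "norm (Q ** F\<^sub>8) \<le> 101 / 100 * (51 / 50 * (5151 / 5000) * (5049 / 5000) * (n * r * u * b * f))"
  proof -
    have "norm F\<^sub>8 \<le> 51 / 50 * n * u * (norm R\<^sub>4 * norm R\<^sub>3)"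
      unfolding F\<^sub>8_def by (rule frob_le_of_abs_le_mult[OF E8 nu0])
    also have "\<dots> \<le> 51 / 50 * n * u * ((5151 / 5000 * r) * (5049 / 5000 * (b * f)))"
      using r1 by (intro mult_left_mono mult_mono nR4 nR3 nu0) auto
    finally have "norm F\<^sub>8 \<le> 51 / 50 * (5151 / 5000) * (5049 / 5000) * (n * r * u * b * f)" by (simp add: mult_ac)
    then show ?thesis
      by (intro order_trans[OF frob_mult_le_spectral_left] mult_mono sQ) auto
  qed
  moreover have "0 \<le> n * r * u * b * f" "0 \<le> n * n * u * (b * g)"
    using n1 r1 u b f0 g0 by auto
  ultimately have "norm (Q ** R - X) \<le> 63 / 20 * (n * r * u * b * f) + 107 / 50 * (n * n * u * (b * g))"
    using F0 by simp
  moreover have "n * r * u * b * f \<le> 10163 / 10000 * (b / a * (n * r * u) * norm X)"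
  proof -
    have "n * r * u * b * f = b / a * (n * r * u) * (a * f)" using a by simp
    also have "\<dots> \<le> b / a * (n * r * u) * (10163 / 10000 * norm X)"
      using a b n1 r1 u by (intro mult_left_mono f) auto
    finally show ?thesis by simp
  qed
  moreover have "n * n * u * (b * g) \<le> 10163 / 10000 * (b / a * (n * n * u) * spectral_norm X)"
  proof -
    have "n * n * u * (b * g) = b / a * (n * n * u) * (a * g)" using a by simp
    also have "\<dots> \<le> b / a * (n * n * u) * (10163 / 10000 * spectral_norm X)"
      using a b n1 u by (intro mult_left_mono g) auto
    finally show ?thesis by simp
  qed
  moreover have "0 \<le> b / a * (n * r * u) * norm X" "0 \<le> b / a * (n * n * u) * spectral_norm X"
    using a b n1 r1 u spectral_norm_nonneg[of X] by auto
  ultimately have "norm (Q ** R - X) \<le> 321 / 100 * (b / a * (n * r * u) * norm X)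
      + 109 / 50 * (b / a * (n * n * u) * spectral_norm X)"
    by linarith
  then show ?thesis by (simp only: r_def power2_eq_square mult.assoc)
qed

section \<open>Error bounds for RCLUPP\<close>

text \<open>Finiteness excludes \<open>sigma_min A = 0\<close>, and the spectral norm is at least
  \<open>sigma_min A\<close>.\<close>

lemma cond_num_cases:
  fixes A :: "real^'n^'m"
  assumes "cond_num A \<noteq> \<infinity>"
  shows "0 < sigma_min A" and "0 < spectral_norm A"
    and "cond_num A = ereal (spectral_norm A / sigma_min A)"
  using assms sigma_min_nonneg[of A] sigma_min_le_spectral_norm[of A]
  by (auto simp: cond_num_def sigma_max_eq split: if_splits)

text \<open>
  \<open>a\<close> and \<open>b\<close> are the bounds for the extremal singular values of the computed \<open>Q\<^sub>1\<close>.
  Multiplied by \<open>e\<close>, the inequalities behind the claims become linear in \<open>r = e/f\<close> and \<open>\<surd>T\<close>.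
\<close>

lemma preconditioning_constants:
  fixes e f T h :: real
  defines "a \<equiv> (157 / 200) / f - (703 / 10000) / e" and "b \<equiv> (643 / 500) / e"
  assumes e: "0 < e" and f: "0 < f" and T: "0 \<le> T"
    and r: "40 / 3 * sqrt T + 1 / 10 < e / f" "5 / 39 < e / f" "e / f < 1"
    and h: "h = 1 / (39 / 50 / f - 1 / 10 / e)"
  shows "T \<le> 23 / 5000" and "0 < a" and "T * b\<^sup>2 \<le> a\<^sup>2 / 64" and "b / a \<le> 643 / 500 / e * h" and "0 < h"
proof -
  define r where "r = e / f"
  note r = r[folded r_def]
  have ar: "e * a = 157 / 200 * r - 703 / 10000"
    and hr: "e * (39 / 50 / f - 1 / 10 / e) = 39 / 50 * r - 1 / 10"
    using e by (simp_all add: a_def r_def right_diff_distrib)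
  have sT: "0 \<le> sqrt T" using T by simp
  \<comment> \<open>Since \<open>r < 1\<close>, at most 0.9 remains for
    \<open>40 / 3 * sqrt T\<close>. The square of 27/400 is below 0.0046, the source of the constant
    23/5000 in the earlier hypotheses.\<close>
  have "sqrt T \<le> 27 / 400" using r by simp
  then have "(sqrt T)\<^sup>2 \<le> (27 / 400)\<^sup>2" using sT by (intro power_mono)
  then show "T \<le> 23 / 5000" using T by (simp add: power_divide)
  have "0 < e * a" using r unfolding ar by simp
  then show a: "0 < a" using e by (simp add: zero_less_mult_iff)
  \<comment> \<open>8 is the root of 64 and 643/500 is \<open>e * b\<close>. As
    \<open>sqrt T\<close> is below 0.075 (r - 0.1), the left side is below 0.7716 r -
    0.07716.\<close>
  have "8 * (643 / 500) * sqrt T \<le> e * a" using r unfolding ar by simp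
  then have "sqrt T * b \<le> a / 8" using e by (simp add: b_def field_simps)
  then have "(sqrt T * b)\<^sup>2 \<le> (a / 8)\<^sup>2" using sT e by (intro power_mono) (auto simp: b_def)
  then show "T * b\<^sup>2 \<le> a\<^sup>2 / 64" using T by (simp add: power_mult_distrib power_divide)
  \<comment> \<open>0.1 / 0.78 = 5/39, so the lower bound 5/39 on \<open>r\<close> says precisely
    that the denominator of \<open>h\<close> is positive.\<close>
  have "0 < e * (39 / 50 / f - 1 / 10 / e)" using r unfolding hr by simp
  then have d: "0 < (39 / 50) / f - (1 / 10) / e" using e by (simp add: zero_less_mult_iff)
  then show "0 < h" by (simp add: h)
  have "e * (39 / 50 / f - 1 / 10 / e) \<le> e * a" using r unfolding hr ar by simp
  then have "39 / 50 / f - 1 / 10 / e \<le> a" using e by simp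
  then have "1 / a \<le> h" unfolding h using d by (intro divide_left_mono) auto
  then have "b * (1 / a) \<le> b * h" using e by (intro mult_left_mono) (auto simp: b_def)
  then show "b / a \<le> 643 / 500 / e * h" by (simp add: b_def)
qed

text \<open>The deterministic core: randomness only decides whether the sketch embeds the range of
  \<open>X\<close>, and here one realization that does is fixed.\<close>

lemma rclupp_embedding_bounds:
  fixes X :: "real^'n::{finite,linorder}^'m" and S :: "real^'m^'s::{finite,linorder}"
    and c :: "('m, 's, 'n) rclupp_run" and u \<epsilon> m s n h k k1 p2 :: real
  defines "e \<equiv> sqrt (1 - \<epsilon>)" and "f \<equiv> sqrt (1 + \<epsilon>)" and "T \<equiv> m * n * u + n * (n + 1) * u"
  assumes u: "0 < u" and dims: "m = real CARD('m)" "s = real CARD('s)" "n = real CARD('n)"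
    and X: "X \<noteq> 0" and eps: "0 < \<epsilon>" "\<epsilon> < 1"
    and emb: "is_embedding \<epsilon> S (range ((*v) X))"
    and model: "rclupp_error_model u X S c"
    and k1: "k1 = frob_norm (hat_M c) / spectral_norm (hat_M c)"
    and k: "k = frob_norm (S ** X - hat_Xs c) / spectral_norm X"
    and p2: "p2 = max (k1 * n * sqrt n * u) (k / (e - k))"
    and h: "h = 1 / (39 / 50 / f - 1 / 10 / e)"
    and r: "40 / 3 * sqrt T + 1 / 10 < e / f" "5 / 39 < e / f" "e / f < 1"
    and S_small: "51 / 50 * m * sqrt n * u * frob_norm S < e"
    and u_small: "u \<le> 1 / (64 * s * n * sqrt n)"
    and cond_M: "cond_num (hat_M c) \<le> ereal (1 / (51 / 2 * s * n * k1 * u))"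
    and cond_MN: "cond_num (hat_M c) * cond_num (hat_N c) \<le> ereal (1 / (107 / 5 * p2))"
  shows "frob_norm (transpose (hat_Q c) ** hat_Q c - mat 1) \<le> 6 * T"
    and "frob_norm (hat_Q c ** hat_R c - X)
      \<le> 109 / 25 / e * h * n * sqrt n * u * frob_norm X + 151 / 50 / e * h * n\<^sup>2 * u * spectral_norm X"
proof -
  let ?M = "hat_M c" and ?N = "hat_N c"
  define \<mu> where "\<mu> = sigma_min ?M"
  define \<nu> where "\<nu> = sigma_min ?N"
  define x where "x = spectral_norm X"
  define a where "a = 157 / 200 / f - 703 / 10000 / e"
  define b where "b = 643 / 500 / e"
  have dec: "(1.02::real) = 51 / 50" "(0.02::real) = 1 / 50" by simp_all
  have P: "permutation_matrix (perm_P c)"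
    and Ea: "\<bar>S ** X - hat_Xs c\<bar>
      \<le> (51 / 50 * m * u) *\<^sub>R (\<bar>S\<bar> ** \<bar>X\<bar>)"
    and Eb: "\<bar>perm_P c ** hat_Xs c - hat_M c ** hat_N c\<bar>
      \<le> (51 / 50 * n * u) *\<^sub>R (\<bar>hat_M c\<bar> ** \<bar>hat_N c\<bar>)"
    and Ec: "\<bar>hat_M c - hat_Qs c ** hat_R0 c\<bar>
      \<le> (51 / 50 * s * n * u) *\<^sub>R \<bar>hat_M c\<bar>"
    and Qs: "norm (transpose (hat_Qs c) ** hat_Qs c - mat 1) \<le> 1 / 50"
    and Ed: "\<bar>hat_R0 c ** hat_N c - hat_R1 c\<bar>
      \<le> (51 / 50 * n * u) *\<^sub>R (\<bar>hat_R0 c\<bar> ** \<bar>hat_N c\<bar>)"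
    and Ee: "\<bar>hat_Q1 c ** hat_R1 c - X\<bar>
      \<le> (51 / 50 * n * u) *\<^sub>R (\<bar>hat_Q1 c\<bar> ** \<bar>hat_R1 c\<bar>)"
    and E1: "\<bar>hat_G c - transpose (hat_Q1 c) ** hat_Q1 c\<bar>
      \<le> (51 / 50 * m * u) *\<^sub>R (\<bar>transpose (hat_Q1 c)\<bar> ** \<bar>hat_Q1 c\<bar>)"
    and E2: "\<bar>transpose (hat_R2 c) ** hat_R2 c - hat_G c\<bar>
      \<le> (51 / 50 * (n + 1) * u) *\<^sub>R (\<bar>transpose (hat_R2 c)\<bar> ** \<bar>hat_R2 c\<bar>)"
    and E3: "\<bar>hat_Q2 c ** hat_R2 c - hat_Q1 c\<bar>
      \<le> (51 / 50 * n * u) *\<^sub>R (\<bar>hat_Q2 c\<bar> ** \<bar>hat_R2 c\<bar>)"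
    and E4: "\<bar>hat_R3 c - hat_R2 c ** hat_R1 c\<bar>
      \<le> (51 / 50 * n * u) *\<^sub>R (\<bar>hat_R2 c\<bar> ** \<bar>hat_R1 c\<bar>)"
    and E5: "\<bar>hat_G1 c - transpose (hat_Q2 c) ** hat_Q2 c\<bar>
      \<le> (51 / 50 * m * u) *\<^sub>R (\<bar>transpose (hat_Q2 c)\<bar> ** \<bar>hat_Q2 c\<bar>)"
    and E6: "\<bar>transpose (hat_R4 c) ** hat_R4 c - hat_G1 c\<bar>
      \<le> (51 / 50 * (n + 1) * u) *\<^sub>R (\<bar>transpose (hat_R4 c)\<bar> ** \<bar>hat_R4 c\<bar>)"
    and E7: "\<bar>hat_Q c ** hat_R4 c - hat_Q2 c\<bar>
      \<le> (51 / 50 * n * u) *\<^sub>R (\<bar>hat_Q c\<bar> ** \<bar>hat_R4 c\<bar>)"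
    and E8: "\<bar>hat_R c - hat_R4 c ** hat_R3 c\<bar>
      \<le> (51 / 50 * n * u) *\<^sub>R (\<bar>hat_R4 c\<bar> ** \<bar>hat_R3 c\<bar>)"
    using model unfolding rclupp_error_model_def Let_def dec dims by blast+
  have m1: "1 \<le> m" and s1: "1 \<le> s" and n1: "1 \<le> n"
    unfolding dims by (simp_all add: Suc_leI)
  define q where "q = sqrt n"
  have q1: "1 \<le> q" using n1 by (simp add: q_def)
  have e: "0 < e" and f: "0 < f" using eps by (simp_all add: e_def f_def)
  have x: "0 < x"
    using X spectral_norm_nonneg[of X] spectral_norm_eq_0[of X] by (simp add: x_def less_le)
  have T0: "0 \<le> T" using m1 n1 u by (simp add: T_def)
  note const = preconditioning_constants[OF e f T0 r h, folded a_def b_def]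
  have nnu: "n * n * u \<le> T" using m1 n1 u by (simp add: T_def algebra_simps)

  have emb1: "e * norm (X *v v) \<le> norm (S *v (X *v v))"
    and emb2: "norm (S *v (X *v v)) \<le> f * norm (X *v v)" for v
  proof -
    have "e\<^sup>2 * (norm (X *v v))\<^sup>2 \<le> (norm (S *v (X *v v)))\<^sup>2"
      "(norm (S *v (X *v v)))\<^sup>2 \<le> f\<^sup>2 * (norm (X *v v))\<^sup>2"
      using emb eps by (simp_all add: is_embedding_def e_def f_def)
    then show "e * norm (X *v v) \<le> norm (S *v (X *v v))" "norm (S *v (X *v v)) \<le> f * norm (X *v v)"
      using f by (auto simp flip: power_mult_distrib intro: power2_le_imp_le)
  qed

  have k0: "0 \<le> k" and kx: "norm (S ** X - hat_Xs c) = k * x"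
    using x by (simp_all add: k x_def)
  \<comment> \<open>Passing from the Frobenius to the spectral norm of \<open>X\<close> costs sqrt
    n, the factor present in \<open>S_small\<close>. It makes the quotient in \<open>p2\<close> have
    a positive denominator.\<close>
  have ke: "k < e"
  proof -
    have "k * x \<le> 51 / 50 * m * u * (norm S * norm X)"
      unfolding kx[symmetric] using Ea u m1 by (intro frob_le_of_abs_le_mult) auto
    also have "\<dots> \<le> 51 / 50 * m * u * (norm S * (q * x))"
      unfolding q_def dims(3) x_def using u m1
      by (intro mult_left_mono frob_le_spectral) auto
    also have "\<dots> = 51 / 50 * m * sqrt n * u * norm S * x" by (simp add: q_def)
    also have "\<dots> < e * x" using S_small x by (rule mult_strict_right_mono)
    finally show ?thesis using x by simp
  qed

  have finM: "cond_num ?M \<noteq> \<infinity>" using cond_M by auto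
  note M = cond_num_cases[OF finM, folded \<mu>_def]
  \<comment> \<open>The first condition number is positive, so an infinite second one would
    contradict the finite bound on the product.\<close>
  have "cond_num ?M * \<infinity> = \<infinity>" using M by simp
  then have finN: "cond_num ?N \<noteq> \<infinity>" using cond_MN by auto
  note N = cond_num_cases[OF finN, folded \<nu>_def]
  have nM: "norm ?M = k1 * spectral_norm ?M" using M by (simp add: k1)
  have k1: "0 < k1"
    unfolding k1 using M(2) spectral_norm_le_frob[of ?M] by (intro divide_pos_pos) linarith+
  \<comment> \<open>The first entry of the maximum is positive even if \<open>k = 0\<close>; this
    allows multiplying out the bound that has \<open>p2\<close> in its denominator.\<close>
  have p2_pos: "0 < p2" using k1 n1 u by (simp add: p2 less_max_iff_disj)
  have M_small: "51 / 2 * (s * n * u * norm ?M) \<le> \<mu>"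
  proof -
    have "spectral_norm ?M / \<mu> \<le> 1 / (51 / 2 * s * n * k1 * u)"
      using cond_M unfolding M(3) by simp
    moreover have "0 < (51 / 2) * s * n * k1 * u" using s1 n1 k1 u by simp
    ultimately have "51 / 2 * s * n * k1 * u * spectral_norm ?M \<le> \<mu>"
      using M by (simp add: field_simps)
    then show ?thesis by (simp add: nM mult_ac)
  qed
  have p2_le: "107 / 5 * (p2 * (spectral_norm ?M * spectral_norm ?N)) \<le> \<mu> * \<nu>"
  proof -
    have "spectral_norm ?M / \<mu> * (spectral_norm ?N / \<nu>) \<le> 1 / (107 / 5 * p2)"
      using cond_MN unfolding M(3) N(3) by simp
    then show ?thesis using M N p2_pos by (simp add: field_simps)
  qed
  have MN0: "0 \<le> spectral_norm ?M * spectral_norm ?N" using M N by simp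
  have MN_small: "107 / 5 * (n * sqrt n * u * norm ?M * spectral_norm ?N) \<le> \<mu> * \<nu>"
  proof -
    have "k1 * n * sqrt n * u * (spectral_norm ?M * spectral_norm ?N)
        \<le> p2 * (spectral_norm ?M * spectral_norm ?N)"
      using MN0 by (intro mult_right_mono) (auto simp: p2)
    with p2_le show ?thesis by (simp add: nM mult_ac)
  qed
  have k_small: "107 / 5 * (k * (spectral_norm ?M * spectral_norm ?N)) \<le> \<mu> * \<nu> * (e - k)"
  proof -
    have "k = k / (e - k) * (e - k)" using ke by simp
    also have "\<dots> \<le> p2 * (e - k)" using ke by (intro mult_right_mono) (auto simp: p2)
    finally have "k * (spectral_norm ?M * spectral_norm ?N)
        \<le> p2 * (e - k) * (spectral_norm ?M * spectral_norm ?N)"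
      by (rule mult_right_mono[OF _ MN0])
    then have "107 / 5 * (k * (spectral_norm ?M * spectral_norm ?N))
        \<le> 107 / 5 * (p2 * (e - k) * (spectral_norm ?M * spectral_norm ?N))"
      by (rule mult_left_mono) simp
    also have "\<dots> = 107 / 5 * (p2 * (spectral_norm ?M * spectral_norm ?N)) * (e - k)"
      by (simp only: mult_ac)
    also have "\<dots> \<le> \<mu> * \<nu> * (e - k)"
      using ke by (intro mult_right_mono p2_le) simp
    finally show ?thesis .
  qed
  have snu: "s * n * u \<le> 1 / 64"
  proof -
    have "64 * s * n * sqrt n * u \<le> 1" using u_small s1 n1 by (simp add: field_simps)
    moreover have "s * n * u * 1 \<le> s * n * u * q" using s1 n1 u q1 by (intro mult_left_mono) auto
    ultimately show ?thesis by (simp add: q_def mult_ac)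
  qed
  have nnu1: "n * n * u \<le> 23 / 5000" using nnu const(1) by simp

  have \<mu>: "\<mu> * norm v \<le> norm (?M *v v)" and \<nu>: "\<nu> * norm v \<le> norm (?N *v v)" for v
    unfolding \<mu>_def \<nu>_def by (rule sigma_min_le)+
  have u0: "0 \<le> u" and s0: "0 \<le> s" using u s1 by simp_all
  note pre = sketch_preconditioner[OF dims(3) u0 s0 nnu1 snu P Eb Ec Qs Ed M(1) \<mu> N(1) \<nu>
      k0 ke kx[unfolded x_def] emb1 M_small MN_small k_small]
  have \<omega>: "0 < \<mu> * \<nu>" and c0: "0 \<le> norm ?M * spectral_norm ?N" using M N by simp_all
  have small: "107 / 5 * (n * sqrt n * u * (norm ?M * spectral_norm ?N)) \<le> \<mu> * \<nu>"
    using MN_small by (simp only: mult.assoc)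
  note Q1 = preconditioned_factor_bounds[OF dims(3) u0 e f \<omega> c0 Ee pre(1,2) small
      emb1 emb2 pre(3,4), folded a_def b_def]

  \<comment> \<open>As \<open>a \<le> b\<close>, one factor \<open>a\<close> in
    \<open>T * b\<^sup>2 \<le> a\<^sup>2 / 64\<close> can be replaced by \<open>b\<close>, which
    then cancels.\<close>
  have "T * b \<le> a / 64"
  proof -
    have "a * norm (axis undefined 1 :: (real, 'n) vec) \<le> b * norm (axis undefined 1 :: (real, 'n) vec)"
      using Q1(2,1) by (rule order_trans)
    then have ab: "a \<le> b" by simp
    then have b: "0 < b" using const(2) by simp
    have "T * b * b \<le> a * a / 64" using const(3) by (simp add: power2_eq_square)
    also have "\<dots> \<le> a * b / 64" using ab const(2) by simp
    finally show ?thesis using b by simp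
  qed
  moreover have "n * n * u * b \<le> T * b" using nnu e by (intro mult_right_mono) (auto simp: b_def)
  ultimately have nnub: "n * n * u * b \<le> a / 64" by simp

  note qr2 = cholesky_qr2_orthogonality[OF dims(1,3) u0 T_def[THEN meta_eq_to_obj_eq]
      const(1,3,2) Q1(2,1) E1 E2 E3 E5 E6 E7]
  show "frob_norm (transpose (hat_Q c) ** hat_Q c - mat 1) \<le> 6 * T" by (rule qr2(7))
  have "norm (hat_Q c ** hat_R c - X) \<le> 321 / 100 * (b / a) * (n * sqrt n * u) * norm X
      + 109 / 50 * (b / a) * (n\<^sup>2 * u) * spectral_norm X"
    by (rule cholesky_qr2_residual[OF dims(3) u0 nnu1 nnub const(2) Q1(2,1) Ee E3 E4 E7 E8
          qr2(1,2,3,4,6)])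
  also have "\<dots> \<le> 321 / 100 * (b * h) * (n * sqrt n * u) * norm X
      + 109 / 50 * (b * h) * (n\<^sup>2 * u) * x"
    unfolding x_def using n1 u x[unfolded x_def] by (intro add_mono mult_right_mono mult_left_mono const(4)) auto
  also have "\<dots> = 321 / 100 * (643 / 500) * (h * n * sqrt n * u * norm X / e) + 109 / 50 * (643 / 500) * (h * n\<^sup>2 * u * x / e)"
    by (simp add: b_def)
  also have "\<dots> \<le> 109 / 25 * (h * n * sqrt n * u * norm X / e) + 151 / 50 * (h * n\<^sup>2 * u * x / e)"
    using const(5) e u n1 x by (intro add_mono mult_right_mono) auto
  finally show "frob_norm (hat_Q c ** hat_R c - X)
      \<le> 109 / 25 / e * h * n * sqrt n * u * frob_norm X + 151 / 50 / e * h * n\<^sup>2 * u * spectral_norm X"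
    by (simp add: x_def)
qed

theorem theorem3p1:
  fixes X :: "real^'n::{finite,linorder}^'m"
    and \<Omega> :: "'w measure"
    and S :: "'w \<Rightarrow> real^'m^'s::{finite,linorder}"
    and run :: "'w \<Rightarrow> ('m, 's, 'n) rclupp_run"
    and u \<epsilon> p m s n k0 h :: real
    and k k1 p1 p2 :: "'w \<Rightarrow> real"
  assumes u: "u = 1 / 2 ^ 53"
    and dims: "m = real CARD('m)" "s = real CARD('s)" "n = real CARD('n)" "n \<le> s" "s \<le> m"
    and rank_X: "rank X = CARD('n)"
    and eps: "0 < \<epsilon>" "\<epsilon> < 1"
    and p: "0 \<le> p" "p < 1"
    and prob: "prob_space \<Omega>"
    and embed: "oblivious_embedding \<Omega> S \<epsilon> p CARD('n)"
    and model: "\<forall>\<omega>\<in>space \<Omega>. rclupp_error_model u X (S \<omega>) (run \<omega>)"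
    and k0: "k0 = frob_norm X / spectral_norm X"
    and k1: "\<forall>\<omega>. k1 \<omega> = frob_norm (hat_M (run \<omega>)) / spectral_norm (hat_M (run \<omega>))"
    and k: "\<forall>\<omega>. k \<omega> = frob_norm (S \<omega> ** X - hat_Xs (run \<omega>)) / spectral_norm X"
    and p1: "\<forall>\<omega>. p1 \<omega> = max (sqrt n) (frob_norm (S \<omega>))"
    and p2: "\<forall>\<omega>. p2 \<omega> = max (k1 \<omega> * n * sqrt n * u) (k \<omega> / (sqrt (1 - \<epsilon>) - k \<omega>))"
    and h: "h = 1 / (0.78 / sqrt (1 + \<epsilon>) - 0.1 / sqrt (1 - \<epsilon>))"
    and cond1: "max (40 / 3 * sqrt (m * n * u + n * (n + 1) * u) + 0.1) (5 / 39)
                  < sqrt (1 - \<epsilon>) / sqrt (1 + \<epsilon>)"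
               "sqrt (1 - \<epsilon>) / sqrt (1 + \<epsilon>) < 1"
    and cond2: "\<forall>\<omega>\<in>space \<Omega>. sqrt (1 - \<epsilon>) > 1.02 * m * sqrt n * u * frob_norm (S \<omega>)"
    and cond3: "\<forall>\<omega>\<in>space \<Omega>. u \<le> min (1 / (64 * p1 \<omega> * m * sqrt n))
                  (min (1 / (64 * s * n * sqrt n))
                       (sqrt (1 - \<epsilon>) / (1.02 * k0 * m * frob_norm (S \<omega>))))"
    and cond4: "\<forall>\<omega>\<in>space \<Omega>. cond_num (hat_M (run \<omega>)) \<le> ereal (1 / (25.5 * s * n * k1 \<omega> * u))"
    and cond5: "\<forall>\<omega>\<in>space \<Omega>. cond_num (hat_M (run \<omega>)) * cond_num (hat_N (run \<omega>))
                  \<le> ereal (1 / (21.4 * p2 \<omega>))"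
  shows "with_prob_at_least \<Omega> (1 - p) (\<lambda>\<omega>.
           frob_norm (transpose (hat_Q (run \<omega>)) ** hat_Q (run \<omega>) - mat 1)
             \<le> 6 * (m * n * u + n * (n + 1) * u) \<and>
           frob_norm (hat_Q (run \<omega>) ** hat_R (run \<omega>) - X)
             \<le> 4.36 / sqrt (1 - \<epsilon>) * h * n * sqrt n * u * frob_norm X
               + 3.02 / sqrt (1 - \<epsilon>) * h * n\<^sup>2 * u * spectral_norm X)"
proof -
  \<comment> \<open>\<open>X\<close> is not random, so its range is a fixed subspace, of dimension n
    by full rank, and the oblivious property applies to it.\<close>
  let ?K = "range ((*v) X)"
  define A where "A = {\<omega> \<in> space \<Omega>. is_embedding \<epsilon> (S \<omega>) ?K}"
  have "subspace ?K"
    by (intro linear_subspace_image subspace_UNIV matrix_vector_mul_linear)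
  moreover have "dim ?K = CARD('n)"
    using rank_X by (simp add: rank_dim_range)
  ultimately have prob_A: "1 - p \<le> measure \<Omega> A"
    using embed by (simp add: oblivious_embedding_def A_def)
  text \<open>Non-measurable sets have measure 0 by convention, so positivity makes \<open>A\<close> an event.\<close>
  then have A: "A \<in> sets \<Omega>"
    using p measure_notin_sets[of A \<Omega>] by fastforce
  have X: "X \<noteq> 0"
    using rank_X rank_eq_0[of X] by auto
  have u0: "0 < u" by (simp add: u)
  have h': "h = 1 / (39 / 50 / sqrt (1 + \<epsilon>) - 1 / 10 / sqrt (1 - \<epsilon>))"
    by (simp add: h)
  have r: "40 / 3 * sqrt (m * n * u + n * (n + 1) * u) + 1 / 10 < sqrt (1 - \<epsilon>) / sqrt (1 + \<epsilon>)"
    "5 / 39 < sqrt (1 - \<epsilon>) / sqrt (1 + \<epsilon>)"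
    using cond1(1) by simp_all
  have "frob_norm (transpose (hat_Q (run \<omega>)) ** hat_Q (run \<omega>) - mat 1)
      \<le> 6 * (m * n * u + n * (n + 1) * u) \<and>
    frob_norm (hat_Q (run \<omega>) ** hat_R (run \<omega>) - X)
      \<le> 4.36 / sqrt (1 - \<epsilon>) * h * n * sqrt n * u * frob_norm X
        + 3.02 / sqrt (1 - \<epsilon>) * h * n\<^sup>2 * u * spectral_norm X" if "\<omega> \<in> A" for \<omega>
  proof -
    have \<omega>: "\<omega> \<in> space \<Omega>" "is_embedding \<epsilon> (S \<omega>) ?K"
      using that by (simp_all add: A_def)
    have S_small: "51 / 50 * m * sqrt n * u * frob_norm (S \<omega>) < sqrt (1 - \<epsilon>)"
      using cond2 \<omega>(1) by simp
    have u_small: "u \<le> 1 / (64 * s * n * sqrt n)"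
      using cond3 \<omega>(1) by simp
    have cond_M: "cond_num (hat_M (run \<omega>)) \<le> ereal (1 / (51 / 2 * s * n * k1 \<omega> * u))"
      using cond4 \<omega>(1) by simp
    have cond_MN: "cond_num (hat_M (run \<omega>)) * cond_num (hat_N (run \<omega>))
        \<le> ereal (1 / (107 / 5 * p2 \<omega>))"
      using cond5 \<omega>(1) by simp
    show ?thesis
      using rclupp_embedding_bounds[OF u0 dims(1-3) X eps \<omega>(2) model[rule_format, OF \<omega>(1)]
          k1[rule_format] k[rule_format] p2[rule_format] h' r cond1(2) S_small u_small cond_M cond_MN]
      by simp
  qed
  with A prob_A show ?thesis
    unfolding with_prob_at_least_def by blast
qed

end
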